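(* Let $A$ be a finite-dimensional Hopf algebra with antipode $s$ over the field $k$. Let $\{a_1,\ldots,a_n\}$ be a basis for $A$, with structure constants $m^{\ell}_{i,j},\Delta^{i,j}_{\ell},s^i_j\in k$ given by $a_ia_j=\sum_{\ell}m^{\ell}_{i,j}a_\ell$, $\Delta(a_\ell)=\sum_{i,j}\Delta^{i,j}_\ell\, a_i\otimes a_j$ and $s(a_j)=\sum_i s^i_j a_i$, and let $P$ be the endomorphism of $A$ defined by $$P(a_j)=\sum_{i}P^i_j a_i,\qquad P^i_j=\sum_{\ell,u,v,w}m^{\ell}_{w,j}\,s^u_\ell\,\Delta^{v,i}_u\,s^w_v\qquad(1\le i,j\le n).$$ Then: (a) $p(P(a))=\mathsf{tr}(s\circ\ell(p)\circ s\circ r(a))=\mathsf{tr}(\ell(s(a))\circ s^2\circ\ell(p))$ for all $p\in A^*$ and $a\in A$. (b) $P=\mathcal{E}_{A^{cop}}(s^2)\circ s$. (c) Integrals and cointegrals for $A$ are unique up to scalar multiple. In particular, if $\lambda\in\int^r$ and $\Lambda\in\int_r$ satisfy $\lambda(\Lambda)=1$, then $P=\lambda\otimes\Lambda$.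
   Context: $\mathrm{End}(A)$ is the space of $k$-linear endomorphisms of $A$, and $\mathsf{tr}$ is the usual trace. $A^*$ is the dual Hopf algebra of $A$, with product $(pq)(a)=p(a_{(1)})q(a_{(2)})$. Sweedler notation $\Delta(a)=a_{(1)}\otimes a_{(2)}$ is used, and $\epsilon$ is the counit of $A$. $A^*\otimes A$ is identified with $\mathrm{End}(A)$ by $(p\otimes a)(b)=p(b)a$ for $p\in A^*$, $a,b\in A$. For $a\in A$ the endomorphisms $\ell(a),r(a)$ of $A$ are $\ell(a)(b)=ab$ and $r(a)(b)=ba$. For $p\in A^*$ the endomorphisms $\ell(p),r(p)$ of $A$ are $\ell(p)(a)=a_{(1)}p(a_{(2)})$ and $r(p)(a)=p(a_{(1)})a_{(2)}$. For a finite-dimensional Hopf algebra $H$ over $k$, $\mathcal{E}_H:\mathrm{End}(H)\to\mathrm{End}(H)$ is the linear map determined by $p(\mathcal{E}_H(f)(a))=\mathsf{tr}(\ell(a)\circ f\circ r(p))$ for all $p\in H^*$, $f\in\mathrm{End}(H)$, $a\in H$, where $\ell(a)$ and $r(p)$ are formed using the product and coproduct of $H$. $A^{cop}$ is the Hopf algebra obtained from $A$ by keeping the product and replacing the coproduct by $\Delta^{cop}(a)=a_{(2)}\otimes a_{(1)}$ (the antipode of a finite-dimensional Hopf algebra is bijective, and $A^{cop}$ has antipode $s^{-1}$). $\int_r$ denotes the set of right integrals for $A$: $\Lambda\in\int_r$ if and only if $\Lambda a=\epsilon(a)\Lambda$ for all $a\in A$. $\int^r$ denotes the set of right integrals for $A^*$: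 $\lambda\in\int^r$ if and only if $\lambda p=p(1)\lambda$ for all $p\in A^*$, equivalently $\lambda(a_{(1)})a_{(2)}=\lambda(a)1$ for all $a\in A$. An endomorphism $\mathcal{P}\in\mathrm{End}(A)$ is called an "integral and cointegral for $A$" if $\mathcal{P}(a_{(1)})\otimes a_{(2)}=\mathcal{P}(a)\otimes 1$ and $(\mathcal{P}(a))b=\epsilon(b)\mathcal{P}(a)$ for all $a,b\in A$. "Unique up to scalar multiple" means that every integral and cointegral for $A$ is a scalar multiple of any given non-zero one. *)

theory Defs
  imports "HOL.Vector_Spaces" "HOL-Library.Function_Algebras"
begin

text \<open>
  The tensor product of a vector space with itself is modelled inside the linear dual of the
  space of bilinear forms: a pure tensor is evaluation at a pair of vectors, and tensors are the
  finite sums of pure tensors.  The lemma \<open>tensor_lift_sum_list\<close> below shows that this has the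
  universal property of the tensor product over a field.  Threefold tensors are
  treated in the same way with trilinear forms.
\<close>

definition linear_form :: "('k::field \<Rightarrow> 'a::ab_group_add \<Rightarrow> 'a) \<Rightarrow> ('a \<Rightarrow> 'k) \<Rightarrow> bool" where
  "linear_form scale p \<longleftrightarrow> Vector_Spaces.linear scale (*) p"

definition linear_endo :: "('k::field \<Rightarrow> 'a::ab_group_add \<Rightarrow> 'a) \<Rightarrow> ('a \<Rightarrow> 'a) \<Rightarrow> bool" where
  "linear_endo scale f \<longleftrightarrow> Vector_Spaces.linear scale scale f"

definition bilinear_map ::
  "('k::field \<Rightarrow> 'a::ab_group_add \<Rightarrow> 'a) \<Rightarrow> ('k \<Rightarrow> 'v::ab_group_add \<Rightarrow> 'v) \<Rightarrow> ('a \<Rightarrow> 'a \<Rightarrow> 'v) \<Rightarrow> bool"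
  where
  "bilinear_map scale scaleV \<beta> \<longleftrightarrow>
     (\<forall>x. Vector_Spaces.linear scale scaleV (\<lambda>y. \<beta> x y)) \<and>
     (\<forall>y. Vector_Spaces.linear scale scaleV (\<lambda>x. \<beta> x y))"

definition trilinear_form ::
  "('k::field \<Rightarrow> 'a::ab_group_add \<Rightarrow> 'a) \<Rightarrow> ('a \<Rightarrow> 'a \<Rightarrow> 'a \<Rightarrow> 'k) \<Rightarrow> bool" where
  "trilinear_form scale \<tau> \<longleftrightarrow>
     (\<forall>y z. linear_form scale (\<lambda>x. \<tau> x y z)) \<and>
     (\<forall>x z. linear_form scale (\<lambda>y. \<tau> x y z)) \<and>
     (\<forall>x y. linear_form scale (\<lambda>z. \<tau> x y z))"

type_synonym ('k, 'a) tensor = "('a \<Rightarrow> 'a \<Rightarrow> 'k) \<Rightarrow> 'k"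
type_synonym ('k, 'a) tensor3 = "('a \<Rightarrow> 'a \<Rightarrow> 'a \<Rightarrow> 'k) \<Rightarrow> 'k"

definition tens :: "('k::field \<Rightarrow> 'a::ab_group_add \<Rightarrow> 'a) \<Rightarrow> 'a \<Rightarrow> 'a \<Rightarrow> ('k, 'a) tensor" where
  "tens scale x y = (\<lambda>\<beta>. if bilinear_map scale (*) \<beta> then \<beta> x y else 0)"

definition tens3 ::
  "('k::field \<Rightarrow> 'a::ab_group_add \<Rightarrow> 'a) \<Rightarrow> 'a \<Rightarrow> 'a \<Rightarrow> 'a \<Rightarrow> ('k, 'a) tensor3" where
  "tens3 scale x y z = (\<lambda>\<tau>. if trilinear_form scale \<tau> then \<tau> x y z else 0)"

definition fun_scale :: "'k::field \<Rightarrow> ('i \<Rightarrow> 'k) \<Rightarrow> 'i \<Rightarrow> 'k" where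
  "fun_scale c t = (\<lambda>i. c * t i)"

definition tensor_space :: "('k::field \<Rightarrow> 'a::ab_group_add \<Rightarrow> 'a) \<Rightarrow> ('k, 'a) tensor set" where
  "tensor_space scale = {t. \<exists>xs. t = (\<Sum>(x, y)\<leftarrow>xs. tens scale x y)}"

text \<open>
  The linear map on tensors induced by a bilinear map \<open>\<beta>\<close>.  Applied to a coproduct, it is
  Sweedler notation: \<open>tensor_lift scale (\<lambda>x y. \<beta> x y) (\<Delta> a)\<close> stands for \<open>\<beta>(a\<^sub>(\<^sub>1\<^sub>), a\<^sub>(\<^sub>2\<^sub>))\<close>.
\<close>

definition tensor_lift ::
  "('k::field \<Rightarrow> 'a::ab_group_add \<Rightarrow> 'a) \<Rightarrow> ('a \<Rightarrow> 'a \<Rightarrow> 'v::ab_group_add) \<Rightarrow> ('k, 'a) tensor \<Rightarrow> 'v"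
  where
  "tensor_lift scale \<beta> t =
     (THE v. \<exists>xs. t = (\<Sum>(x, y)\<leftarrow>xs. tens scale x y) \<and> v = (\<Sum>(x, y)\<leftarrow>xs. \<beta> x y))"

lemma vector_space_field: "vector_space ((*) :: 'k::field \<Rightarrow> 'k \<Rightarrow> 'k)"
  by unfold_locales (auto simp: algebra_simps)

lemma vector_space_fun_scale: "vector_space (fun_scale :: 'k::field \<Rightarrow> ('i \<Rightarrow> 'k) \<Rightarrow> 'i \<Rightarrow> 'k)"
  by unfold_locales (auto simp: fun_scale_def algebra_simps fun_eq_iff)

lemma linear_forms_separate:
  assumes "vector_space scale" and "\<And>p. linear_form scale p \<Longrightarrow> p v = p w"
  shows "v = w"
proof -
  interpret vector_space scale by fact
  interpret K: vector_space "(*) :: 'a \<Rightarrow> 'a \<Rightarrow> 'a" by (rule vector_space_field)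
  interpret vp: vector_space_pair scale "(*) :: 'a \<Rightarrow> 'a \<Rightarrow> 'a" ..
  have "v - w = 0"
  proof (rule ccontr)
    assume "v - w \<noteq> 0"
    then have ind: "independent {v - w}" by (simp add: dependent_single)
    define p where "p = vp.construct {v - w} (\<lambda>_. 1)"
    have "linear_form scale p" unfolding linear_form_def p_def by (rule vp.linear_construct[OF ind])
    moreover have "p (v - w) = 1" unfolding p_def by (simp add: vp.construct_basis[OF ind])
    ultimately show False
      using assms(2)[of p] by (simp add: linear_form_def vp.linear_diff)
  qed
  then show ?thesis by simp
qed

lemma tensor_lift_sum_list:
  fixes scale :: "'k::field \<Rightarrow> 'a::ab_group_add \<Rightarrow> 'a" and scaleV :: "'k \<Rightarrow> 'v::ab_group_add \<Rightarrow> 'v"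
  assumes \<beta>: "bilinear_map scale scaleV \<beta>"
  shows "tensor_lift scale \<beta> (\<Sum>(x, y)\<leftarrow>xs. tens scale x y) = (\<Sum>(x, y)\<leftarrow>xs. \<beta> x y)"
  unfolding tensor_lift_def
proof (rule the_equality)
  fix v assume "\<exists>ys. (\<Sum>(x, y)\<leftarrow>xs. tens scale x y) = (\<Sum>(x, y)\<leftarrow>ys. tens scale x y) \<and>
    v = (\<Sum>(x, y)\<leftarrow>ys. \<beta> x y)"
  then obtain ys where ys: "(\<Sum>(x, y)\<leftarrow>xs. tens scale x y) = (\<Sum>(x, y)\<leftarrow>ys. tens scale x y)"
    and v: "v = (\<Sum>(x, y)\<leftarrow>ys. \<beta> x y)" by blast
  have V: "vector_space scaleV"
    using \<beta> by (auto simp: bilinear_map_def Vector_Spaces.linear_def)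
  show "v = (\<Sum>(x, y)\<leftarrow>xs. \<beta> x y)"
  proof (rule linear_forms_separate[OF V])
    fix p assume p: "linear_form scaleV p"
    have bil: "bilinear_map scale (*) (\<lambda>x y. p (\<beta> x y))"
      using \<beta> p Vector_Spaces.linear_compose[of scale scaleV _ "(*)" p]
      by (auto simp: bilinear_map_def linear_form_def comp_def)
    interpret p: Vector_Spaces.linear scaleV "(*)" p
      using p by (simp add: linear_form_def)
    have ev: "(\<Sum>(x, y)\<leftarrow>zs. tens scale x y) (\<lambda>x y. p (\<beta> x y)) = p (\<Sum>(x, y)\<leftarrow>zs. \<beta> x y)" for zs
    proof (induction zs)
      case Nil
      then show ?case by (simp add: p.zero)
    next
      case (Cons z zs)
      then show ?case
        using bil by (cases z) (simp add: p.add tens_def)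
    qed
    show "p v = p (\<Sum>(x, y)\<leftarrow>xs. \<beta> x y)"
      using ev[of xs] ev[of ys] ys v by simp
  qed
qed auto

text \<open>
  The trace is the sum of the diagonal matrix coefficients in some basis; by
  \<open>endo_trace_eq\<close> any finite basis gives the same value.
\<close>

definition endo_trace :: "('k::field \<Rightarrow> 'a::ab_group_add \<Rightarrow> 'a) \<Rightarrow> ('a \<Rightarrow> 'a) \<Rightarrow> 'k" where
  "endo_trace scale f =
     (let B = (SOME B. \<not> module.dependent scale B \<and> module.span scale B = UNIV)
      in \<Sum>b\<in>B. module.representation scale B (f b) b)"

lemma endo_trace_eq:
  fixes scale :: "'k::field \<Rightarrow> 'a::ab_group_add \<Rightarrow> 'a"
  assumes f: "linear_endo scale f" and C: "finite C" "\<not> module.dependent scale C"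
    "module.span scale C = UNIV"
  shows "endo_trace scale f = (\<Sum>c\<in>C. module.representation scale C (f c) c)"
proof -
  interpret vector_space scale
    using f by (simp add: linear_endo_def Vector_Spaces.linear_def)
  interpret f: Vector_Spaces.linear scale scale f
    using f by (simp add: linear_endo_def)
  define B where "B = (SOME B. independent B \<and> span B = UNIV)"
  have "\<exists>B. independent B \<and> span B = UNIV" using C by blast
  from someI_ex[OF this] have B: "independent B" "span B = UNIV" by (simp_all add: B_def)
  have finB: "finite B"
    using independent_span_bound[OF C(1) B(1)] C(3) by auto
  have rep: "representation E (f b) e' = (\<Sum>c\<in>F. representation F b c * representation E (f c) e')"
    if E: "independent E" "span E = UNIV" and F: "finite F" "independent F" "span F = UNIV"
    for E F b e'
  proof -
    have "f b = f (\<Sum>c\<in>F. scale (representation F b c) c)"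
      using sum_representation_eq[OF F(2) _ F(1) subset_refl, of b] F(3) by simp
    also have "\<dots> = (\<Sum>c\<in>F. scale (representation F b c) (f c))"
      by (simp add: f.sum f.scale)
    finally show ?thesis
      by (simp add: representation_sum[OF E(1)] representation_scale[OF E(1)] E(2))
  qed
  have "(\<Sum>b\<in>B. representation B (f b) b) =
      (\<Sum>b\<in>B. \<Sum>c\<in>C. representation C b c * representation B (f c) b)"
    by (intro sum.cong refl rep B C)
  also have "\<dots> = (\<Sum>c\<in>C. \<Sum>b\<in>B. representation C b c * representation B (f c) b)"
    by (rule sum.swap)
  also have "\<dots> = (\<Sum>c\<in>C. representation C (f c) c)"
  proof (rule sum.cong[OF refl])
    fix c
    have "representation C (f c) c = representation C (\<Sum>b\<in>B. scale (representation B (f c) b) b) c"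
      using sum_representation_eq[OF B(1) _ finB subset_refl, of "f c"] B(2) by simp
    also have "\<dots> = (\<Sum>b\<in>B. representation B (f c) b * representation C b c)"
      using C(2,3) by (simp add: representation_sum representation_scale)
    finally show "(\<Sum>b\<in>B. representation C b c * representation B (f c) b) = representation C (f c) c"
      by (simp add: mult.commute)
  qed
  finally show ?thesis by (simp add: endo_trace_def B_def Let_def)
qed

locale coalgebra = vector_space scale
  for scale :: "'k::field \<Rightarrow> 'a::ab_group_add \<Rightarrow> 'a" +
  fixes \<Delta> :: "'a \<Rightarrow> ('k, 'a) tensor" and \<epsilon> :: "'a \<Rightarrow> 'k"
  assumes comult_tensor: "\<Delta> a \<in> tensor_space scale"
    and comult_linear: "Vector_Spaces.linear scale fun_scale \<Delta>"
    and counit_linear: "linear_form scale \<epsilon>"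
    and coassoc:
      "tensor_lift scale (\<lambda>x y. tensor_lift scale (\<lambda>u v. tens3 scale u v y) (\<Delta> x)) (\<Delta> a) =
       tensor_lift scale (\<lambda>x y. tensor_lift scale (\<lambda>u v. tens3 scale x u v) (\<Delta> y)) (\<Delta> a)"
    and counit_left: "tensor_lift scale (\<lambda>x y. scale (\<epsilon> x) y) (\<Delta> a) = a"
    and counit_right: "tensor_lift scale (\<lambda>x y. scale (\<epsilon> y) x) (\<Delta> a) = a"

text \<open>
  The class \<open>ring_1\<close> includes \<open>0 \<noteq> 1\<close>, which is no restriction here: it follows
  from \<open>\<epsilon> 1 = 1\<close>.
\<close>

locale bialgebra = coalgebra scale \<Delta> \<epsilon>
  for scale :: "'k::field \<Rightarrow> 'a::ring_1 \<Rightarrow> 'a" and \<Delta> \<epsilon> +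
  assumes scale_mult_left: "scale c a * b = scale c (a * b)"
    and scale_mult_right: "a * scale c b = scale c (a * b)"
    and comult_mult:
      "\<Delta> (a * b) =
       tensor_lift scale (\<lambda>x y. tensor_lift scale (\<lambda>u v. tens scale (x * u) (y * v)) (\<Delta> b)) (\<Delta> a)"
    and comult_one: "\<Delta> 1 = tens scale 1 1"
    and counit_mult: "\<epsilon> (a * b) = \<epsilon> a * \<epsilon> b"
    and counit_one: "\<epsilon> 1 = 1"

locale hopf_algebra = bialgebra scale \<Delta> \<epsilon>
  for scale :: "'k::field \<Rightarrow> 'a::ring_1 \<Rightarrow> 'a" and \<Delta> \<epsilon> +
  fixes s :: "'a \<Rightarrow> 'a"
  assumes antipode_linear: "linear_endo scale s"
    and antipode_left: "tensor_lift scale (\<lambda>x y. s x * y) (\<Delta> a) = scale (\<epsilon> a) 1"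
    and antipode_right: "tensor_lift scale (\<lambda>x y. x * s y) (\<Delta> a) = scale (\<epsilon> a) 1"

definition comult_cop ::
  "('k::field \<Rightarrow> 'a::ab_group_add \<Rightarrow> 'a) \<Rightarrow> ('a \<Rightarrow> ('k, 'a) tensor) \<Rightarrow> 'a \<Rightarrow> ('k, 'a) tensor" where
  "comult_cop scale \<Delta> a = tensor_lift scale (\<lambda>x y. tens scale y x) (\<Delta> a)"

definition dual_mult ::
  "('k::field \<Rightarrow> 'a::ab_group_add \<Rightarrow> 'a) \<Rightarrow> ('a \<Rightarrow> ('k, 'a) tensor) \<Rightarrow> ('a \<Rightarrow> 'k) \<Rightarrow> ('a \<Rightarrow> 'k) \<Rightarrow> 'a \<Rightarrow> 'k"
  where
  "dual_mult scale \<Delta> p q a = tensor_lift scale (\<lambda>x y. p x * q y) (\<Delta> a)"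

definition lmult :: "'a::times \<Rightarrow> 'a \<Rightarrow> 'a" where
  "lmult a = (\<lambda>b. a * b)"

definition rmult :: "'a::times \<Rightarrow> 'a \<Rightarrow> 'a" where
  "rmult a = (\<lambda>b. b * a)"

definition lact ::
  "('k::field \<Rightarrow> 'a::ab_group_add \<Rightarrow> 'a) \<Rightarrow> ('a \<Rightarrow> ('k, 'a) tensor) \<Rightarrow> ('a \<Rightarrow> 'k) \<Rightarrow> 'a \<Rightarrow> 'a" where
  "lact scale \<Delta> p = (\<lambda>a. tensor_lift scale (\<lambda>x y. scale (p y) x) (\<Delta> a))"

definition ract ::
  "('k::field \<Rightarrow> 'a::ab_group_add \<Rightarrow> 'a) \<Rightarrow> ('a \<Rightarrow> ('k, 'a) tensor) \<Rightarrow> ('a \<Rightarrow> 'k) \<Rightarrow> 'a \<Rightarrow> 'a" where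
  "ract scale \<Delta> p = (\<lambda>a. tensor_lift scale (\<lambda>x y. scale (p x) y) (\<Delta> a))"

text \<open>The identification of \<open>A\<^sup>* \<otimes> A\<close> with \<open>End(A)\<close>, on pure tensors.\<close>

definition dual_tens :: "('k::field \<Rightarrow> 'a::ab_group_add \<Rightarrow> 'a) \<Rightarrow> ('a \<Rightarrow> 'k) \<Rightarrow> 'a \<Rightarrow> 'a \<Rightarrow> 'a" where
  "dual_tens scale p a = (\<lambda>b. scale (p b) a)"

text \<open>
  \<open>\<E>\<^sub>H\<close> for a Hopf algebra \<open>H\<close> with coproduct \<open>\<Delta>\<close>; apart from the vector space
  structure it depends only on the product and the coproduct of \<open>H\<close>.
\<close>

definition hopf_E ::
  "('k::field \<Rightarrow> 'a::ring_1 \<Rightarrow> 'a) \<Rightarrow> ('a \<Rightarrow> ('k, 'a) tensor) \<Rightarrow> ('a \<Rightarrow> 'a) \<Rightarrow> 'a \<Rightarrow> 'a" where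
  "hopf_E scale \<Delta> f =
     (THE g. linear_endo scale g \<and>
        (\<forall>p a. linear_form scale p \<longrightarrow>
           p (g a) = endo_trace scale (lmult a \<circ> f \<circ> ract scale \<Delta> p)))"

definition right_integrals ::
  "('k::field \<Rightarrow> 'a::ring_1 \<Rightarrow> 'a) \<Rightarrow> ('a \<Rightarrow> 'k) \<Rightarrow> 'a set" where
  "right_integrals scale \<epsilon> = {L. \<forall>a. L * a = scale (\<epsilon> a) L}"

definition dual_right_integrals ::
  "('k::field \<Rightarrow> 'a::ring_1 \<Rightarrow> 'a) \<Rightarrow> ('a \<Rightarrow> ('k, 'a) tensor) \<Rightarrow> ('a \<Rightarrow> 'k) set" where
  "dual_right_integrals scale \<Delta> =
     {l. linear_form scale l \<and>
         (\<forall>p. linear_form scale p \<longrightarrow> dual_mult scale \<Delta> l p = (\<lambda>a. p 1 * l a))}"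

definition integral_and_cointegral ::
  "('k::field \<Rightarrow> 'a::ring_1 \<Rightarrow> 'a) \<Rightarrow> ('a \<Rightarrow> ('k, 'a) tensor) \<Rightarrow> ('a \<Rightarrow> 'k) \<Rightarrow> ('a \<Rightarrow> 'a) \<Rightarrow> bool" where
  "integral_and_cointegral scale \<Delta> \<epsilon> Q \<longleftrightarrow>
     linear_endo scale Q \<and>
     (\<forall>a. tensor_lift scale (\<lambda>x y. tens scale (Q x) y) (\<Delta> a) = tens scale (Q a) 1) \<and>
     (\<forall>a b. Q a * b = scale (\<epsilon> b) (Q a))"

end

theory Submission
  imports Defs
begin

text \<open>
  The structure constants spell out a trace: \<open>p(P(a)) = tr (\<ell>(p) \<circ> s \<circ> r(a) \<circ> s)\<close>.  Cyclicity of the trace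
  and \<open>s(b a) = s(a) s(b)\<close> bring this into the two asserted forms, and the second of them is the trace
  that defines \<open>\<E>\<close> for \<open>A\<^sup>c\<^sup>o\<^sup>p\<close> at \<open>s(a)\<close>, because \<open>\<ell>(p)\<close> is the operator \<open>r(p)\<close> of the opposite coproduct.
  This gives \<open>P = \<E>(s\<^sup>2) \<circ> s\<close>.

  The assertions on integrals follow from one identity, \<open>l(L) P = l \<otimes> L\<close> for arbitrary right integrals
  \<open>l\<close> of the dual and \<open>L\<close> of \<open>A\<close> (\<open>trace_integrals\<close>).  The source is the equation
  \<open>l(L\<^sub>1 a) L\<^sub>2 = l(L) s(a)\<close> (\<open>integrals_give_antipode\<close>), which holds because its left side
  satisfies the equation that characterizes multiples of the convolution inverse of the identity
  (\<open>linear_eq_mult_antipode\<close>).  It gives \<open>l(L) tr (s \<circ> f) = l(L\<^sub>1 f(L\<^sub>2))\<close>, and for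
  \<open>f = r(a) \<circ> s \<circ> \<ell>(p)\<close> the right side is \<open>l(L\<^sub>1 s(L\<^sub>2) a) p(L\<^sub>3) = l(a) p(L)\<close>.

  With \<open>l(L) = 1\<close> the identity is \<open>P = l \<otimes> L\<close>.  With \<open>l(L) = 0\<close> it says \<open>l \<otimes> L = 0\<close>, so that nonzero
  integrals always pair to a nonzero scalar.  Therefore a nonzero integral and cointegral provides
  a pair with \<open>l(L) \<noteq> 0\<close>, and with such a pair the identity makes all integrals and cointegrals
  multiples of \<open>P\<close> (\<open>integral_and_cointegral_unique\<close>).
\<close>

section \<open>Linear and bilinear maps on tensors\<close>

lemma vs_linearI:
  assumes "vector_space s1" "vector_space s2" "\<And>x y. f (x + y) = f x + f y"
    "\<And>c x. f (s1 c x) = s2 c (f x)"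
  shows "Vector_Spaces.linear s1 s2 f"
  using assms by (simp add: Vector_Spaces.linear_iff)

lemma bilinear_mapI:
  assumes "vector_space scale" "vector_space scaleV"
    "\<And>x x' y. \<beta> (x + x') y = \<beta> x y + \<beta> x' y" "\<And>x y y'. \<beta> x (y + y') = \<beta> x y + \<beta> x y'"
    "\<And>c x y. \<beta> (scale c x) y = scaleV c (\<beta> x y)" "\<And>c x y. \<beta> x (scale c y) = scaleV c (\<beta> x y)"
  shows "bilinear_map scale scaleV \<beta>"
  using assms by (simp add: bilinear_map_def vs_linearI)

lemma bilinear_mapD:
  assumes "bilinear_map scale scaleV \<beta>"
  shows "vector_space scale" "vector_space scaleV"
    "\<beta> (x + x') y = \<beta> x y + \<beta> x' y" "\<beta> x (y + y') = \<beta> x y + \<beta> x y'"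
    "\<beta> (scale c x) y = scaleV c (\<beta> x y)" "\<beta> x (scale c y) = scaleV c (\<beta> x y)"
  using assms by (auto simp: bilinear_map_def Vector_Spaces.linear_iff)

lemma linear_mapD:
  assumes "Vector_Spaces.linear s1 s2 f"
  shows "vector_space s1" "vector_space s2"
    "f (x + y) = f x + f y" "f (s1 c x) = s2 c (f x)" "f 0 = 0"
    "f (\<Sum>i\<in>I. g i) = (\<Sum>i\<in>I. f (g i))"
proof -
  interpret Vector_Spaces.linear s1 s2 f by fact
  show "vector_space s1" "vector_space s2"
    "f (x + y) = f x + f y" "f (s1 c x) = s2 c (f x)" "f 0 = 0"
    "f (\<Sum>i\<in>I. g i) = (\<Sum>i\<in>I. f (g i))"
    by (fact vs1.vector_space_axioms vs2.vector_space_axioms add scale zero sum)+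
qed

lemma linear_sum_list:
  assumes "Vector_Spaces.linear s1 s2 f"
  shows "f (\<Sum>(x, y)\<leftarrow>xs. g x y) = (\<Sum>(x, y)\<leftarrow>xs. f (g x y))"
  by (induction xs) (auto simp: linear_mapD(3,5)[OF assms])

lemma bilinear_map_compose:
  assumes "bilinear_map scale scaleV \<beta>" "Vector_Spaces.linear scaleV scaleW f"
  shows "bilinear_map scale scaleW (\<lambda>x y. f (\<beta> x y))"
  by (rule bilinear_mapI) (simp_all add: bilinear_mapD[OF assms(1)] linear_mapD[OF assms(2)])

lemma sum_list_tens_eval:
  assumes "bilinear_map scale (*) \<beta>"
  shows "(\<Sum>(x, y)\<leftarrow>xs. tens scale x y) \<beta> = (\<Sum>(x, y)\<leftarrow>xs. \<beta> x y)"
  using assms by (induction xs) (auto simp: tens_def)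

lemma bilinear_map_tens:
  assumes "vector_space scale"
  shows "bilinear_map scale fun_scale (tens scale)"
  by (rule bilinear_mapI)
    (auto simp: assms vector_space_fun_scale tens_def fun_scale_def fun_eq_iff bilinear_mapD)

text \<open>
  A scalar is absorbed into the first factors, so the finite sums of pure tensors are closed under
  scalars; this makes it possible to compute \<open>\<Delta> (scale c a)\<close> from a representation of \<open>\<Delta> a\<close>.
\<close>

lemma fun_scale_sum_list_tens:
  assumes "vector_space scale"
  shows "fun_scale c (\<Sum>(x, y)\<leftarrow>xs. tens scale x y) = (\<Sum>(x, y)\<leftarrow>map (\<lambda>(x, y). (scale c x, y)) xs. tens scale x y)"
proof -
  have "fun_scale c (\<Sum>(x, y)\<leftarrow>xs. tens scale x y) = (\<Sum>(x, y)\<leftarrow>xs. fun_scale c (tens scale x y))"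
    by (induction xs) (auto simp: fun_scale_def fun_eq_iff algebra_simps)
  then show ?thesis
    by (simp add: o_def case_prod_unfold bilinear_mapD(5)[OF bilinear_map_tens[OF assms]])
qed

section \<open>Sweedler notation\<close>

text \<open>
  Identities with coproducts are proved for integrands with values in any vector space.  A
  representation of \<open>\<Delta> a\<close> as a finite sum of pure tensors turns them into identities of list sums.
\<close>

context coalgebra
begin

abbreviation sweedler :: "('a \<Rightarrow> 'a \<Rightarrow> 'v::ab_group_add) \<Rightarrow> 'a \<Rightarrow> 'v" where
  "sweedler \<beta> a \<equiv> tensor_lift scale \<beta> (\<Delta> a)"

lemma comult_sum_list: obtains xs where "\<Delta> a = (\<Sum>(x, y)\<leftarrow>xs. tens scale x y)"
  using comult_tensor[of a] by (auto simp: tensor_space_def)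

lemma linear_sweedler:
  assumes \<beta>: "bilinear_map scale scaleV \<beta>"
  shows "Vector_Spaces.linear scale scaleV (sweedler \<beta>)"
proof (rule vs_linearI)
  note L = tensor_lift_sum_list[OF \<beta>]
  fix a b c
  obtain xs where xs: "\<Delta> a = (\<Sum>(x, y)\<leftarrow>xs. tens scale x y)" by (rule comult_sum_list)
  obtain ys where ys: "\<Delta> b = (\<Sum>(x, y)\<leftarrow>ys. tens scale x y)" by (rule comult_sum_list)
  have "\<Delta> (a + b) = (\<Sum>(x, y)\<leftarrow>xs @ ys. tens scale x y)"
    by (simp add: linear_mapD[OF comult_linear] xs ys)
  then show "sweedler \<beta> (a + b) = sweedler \<beta> a + sweedler \<beta> b"
    by (simp only: xs ys L) simp
  have "\<Delta> (scale c a) = (\<Sum>(x, y)\<leftarrow>map (\<lambda>(x, y). (scale c x, y)) xs. tens scale x y)"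
    by (simp only: linear_mapD[OF comult_linear] xs fun_scale_sum_list_tens[OF vector_space_axioms])
  moreover have "(\<Sum>(x, y)\<leftarrow>map (\<lambda>(x, y). (scale c x, y)) xs. \<beta> x y) = scaleV c (\<Sum>(x, y)\<leftarrow>xs. \<beta> x y)"
  proof (induction xs)
    case Nil
    interpret V: vector_space scaleV by (rule bilinear_mapD[OF \<beta>])
    show ?case by simp
  next
    case (Cons z zs)
    interpret V: vector_space scaleV by (rule bilinear_mapD[OF \<beta>])
    show ?case using Cons by (cases z) (simp add: bilinear_mapD[OF \<beta>] V.scale_right_distrib)
  qed
  ultimately show "sweedler \<beta> (scale c a) = scaleV c (sweedler \<beta> a)"
    by (simp only: xs L)
qed (use bilinear_mapD[OF \<beta>] in simp_all)

lemma sweedler_compose: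
  assumes f: "Vector_Spaces.linear scaleV scaleW f" and \<beta>: "bilinear_map scale scaleV \<beta>"
  shows "f (sweedler \<beta> a) = sweedler (\<lambda>x y. f (\<beta> x y)) a"
proof -
  obtain xs where xs: "\<Delta> a = (\<Sum>(x, y)\<leftarrow>xs. tens scale x y)" by (rule comult_sum_list)
  show ?thesis
    by (simp add: xs tensor_lift_sum_list[OF \<beta>] linear_sum_list[OF f]
        tensor_lift_sum_list[OF bilinear_map_compose[OF \<beta> f]])
qed

text \<open>
  An inner Sweedler sum that depends linearly on a further variable can be the integrand of an outer
  one; this is what makes nested sums well defined.
\<close>

lemma linear_sweedler_param:
  assumes \<beta>: "\<And>z. bilinear_map scale scaleV (\<beta> z)"
    and lin: "\<And>x y. Vector_Spaces.linear scaleU scaleV (\<lambda>z. \<beta> z x y)"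
  shows "Vector_Spaces.linear scaleU scaleV (\<lambda>z. sweedler (\<beta> z) a)"
proof -
  obtain xs where xs: "\<Delta> a = (\<Sum>(x, y)\<leftarrow>xs. tens scale x y)" by (rule comult_sum_list)
  interpret V: vector_space scaleV by (rule bilinear_mapD[OF \<beta>])
  interpret U: vector_space scaleU using linear_mapD[OF lin] by simp
  have "Vector_Spaces.linear scaleU scaleV (\<lambda>z. \<Sum>(x, y)\<leftarrow>xs. \<beta> z x y)"
  proof (induction xs)
    case Nil
    show ?case by (auto intro!: vs_linearI simp: U.vector_space_axioms V.vector_space_axioms)
  next
    case (Cons q qs)
    then show ?case
      by (cases q) (auto intro!: vs_linearI
        simp: U.vector_space_axioms V.vector_space_axioms linear_mapD(3,4)[OF lin]
          linear_mapD(3,4)[OF Cons] V.scale_right_distrib algebra_simps)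
  qed
  then show ?thesis by (simp add: xs tensor_lift_sum_list[OF \<beta>])
qed

lemma bilinear_sweedler_left:
  assumes "\<And>y. bilinear_map scale scaleV (\<lambda>u v. \<tau> u v y)"
    "\<And>u v. Vector_Spaces.linear scale scaleV (\<lambda>y. \<tau> u v y)"
  shows "bilinear_map scale scaleV (\<lambda>x y. sweedler (\<lambda>u v. \<tau> u v y) x)"
  unfolding bilinear_map_def using linear_sweedler[OF assms(1)] linear_sweedler_param[OF assms]
  by blast

lemma bilinear_sweedler_right:
  assumes "\<And>x. bilinear_map scale scaleV (\<lambda>u v. \<tau> x u v)"
    "\<And>u v. Vector_Spaces.linear scale scaleV (\<lambda>x. \<tau> x u v)"
  shows "bilinear_map scale scaleV (\<lambda>x y. sweedler (\<lambda>u v. \<tau> x u v) y)"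
  unfolding bilinear_map_def using linear_sweedler[OF assms(1)] linear_sweedler_param[OF assms]
  by blast

text \<open>
  Coassociativity is an equation of threefold tensors, which are functionals on trilinear forms;
  evaluating both of its sides at \<open>\<tau>\<close> gives the equation for \<open>\<tau>\<close>.
\<close>

lemma sweedler_coassoc_form:
  assumes \<tau>: "trilinear_form scale \<tau>"
  shows "sweedler (\<lambda>x y. sweedler (\<lambda>u v. \<tau> u v y) x) a = sweedler (\<lambda>x y. sweedler (\<lambda>u v. \<tau> x u v) y) a"
proof -
  have ev: "Vector_Spaces.linear fun_scale (*) (\<lambda>t. t \<tau>)"
    by (intro vs_linearI vector_space_fun_scale vector_space_field) (auto simp: fun_scale_def)
  have lin: "Vector_Spaces.linear scale fun_scale (\<lambda>x. tens3 scale x y z)"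
    "Vector_Spaces.linear scale fun_scale (\<lambda>x. tens3 scale y x z)"
    "Vector_Spaces.linear scale fun_scale (\<lambda>x. tens3 scale y z x)" for y z
    by (auto intro!: vs_linearI vector_space_fun_scale vector_space_axioms
        simp: tens3_def fun_eq_iff fun_scale_def trilinear_form_def linear_form_def Vector_Spaces.linear_iff)
  have bil: "bilinear_map scale fun_scale (\<lambda>u v. tens3 scale u v y)"
    "bilinear_map scale fun_scale (\<lambda>u v. tens3 scale y u v)" for y
    by (auto simp: bilinear_map_def lin)
  have val: "tens3 scale x y z \<tau> = \<tau> x y z" for x y z using \<tau> by (simp add: tens3_def)
  show ?thesis
    using arg_cong[OF coassoc[of a], of "\<lambda>t. t \<tau>"]
    by (simp add: sweedler_compose[OF ev bilinear_sweedler_left, OF bil(1) lin(3)]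
      sweedler_compose[OF ev bilinear_sweedler_right, OF bil(2) lin(1)]
      sweedler_compose[OF ev bil(1)] sweedler_compose[OF ev bil(2)] val)
qed

text \<open>
  Trilinear maps with values in any vector space reduce to forms, because linear forms separate points.
\<close>

lemma sweedler_coassoc:
  fixes \<tau> :: "'a \<Rightarrow> 'a \<Rightarrow> 'a \<Rightarrow> 'v::ab_group_add"
  assumes \<tau>: "\<And>y z. Vector_Spaces.linear scale scaleV (\<lambda>x. \<tau> x y z)"
    "\<And>x z. Vector_Spaces.linear scale scaleV (\<lambda>y. \<tau> x y z)"
    "\<And>x y. Vector_Spaces.linear scale scaleV (\<lambda>z. \<tau> x y z)"
  shows "sweedler (\<lambda>x y. sweedler (\<lambda>u v. \<tau> u v y) x) a = sweedler (\<lambda>x y. sweedler (\<lambda>u v. \<tau> x u v) y) a"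
proof (rule linear_forms_separate)
  show "vector_space scaleV" using linear_mapD[OF \<tau>(1)] by simp
  fix p assume p: "linear_form scaleV p"
  then have p': "Vector_Spaces.linear scaleV (*) p" by (simp add: linear_form_def)
  have bil: "bilinear_map scale scaleV (\<lambda>u v. \<tau> u v y)"
    "bilinear_map scale scaleV (\<lambda>u v. \<tau> y u v)" for y
    by (auto simp: bilinear_map_def \<tau>)
  have "trilinear_form scale (\<lambda>x y z. p (\<tau> x y z))"
    unfolding trilinear_form_def linear_form_def
    using Vector_Spaces.linear_compose[OF _ p'] \<tau> unfolding o_def by blast
  from sweedler_coassoc_form[OF this, of a]
  show "p (sweedler (\<lambda>x y. sweedler (\<lambda>u v. \<tau> u v y) x) a) = p (sweedler (\<lambda>x y. sweedler (\<lambda>u v. \<tau> x u v) y) a)"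
    by (simp add: sweedler_compose[OF p' bilinear_sweedler_left, OF bil(1) \<tau>(3)]
      sweedler_compose[OF p' bilinear_sweedler_right, OF bil(2) \<tau>(1)]
      sweedler_compose[OF p' bil(1)] sweedler_compose[OF p' bil(2)])
qed


lemma sweedler_swap:
  assumes "\<And>x y. bilinear_map scale scaleV (\<lambda>u v. \<beta> x y u v)"
    "\<And>u v. bilinear_map scale scaleV (\<lambda>x y. \<beta> x y u v)"
  shows "sweedler (\<lambda>x y. sweedler (\<lambda>u v. \<beta> x y u v) b) a =
    sweedler (\<lambda>u v. sweedler (\<lambda>x y. \<beta> x y u v) a) b"
proof -
  obtain as where as: "\<Delta> a = (\<Sum>(x, y)\<leftarrow>as. tens scale x y)" by (rule comult_sum_list)
  obtain bs where bs: "\<Delta> b = (\<Sum>(x, y)\<leftarrow>bs. tens scale x y)" by (rule comult_sum_list)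
  have lin: "Vector_Spaces.linear scale scaleV (\<lambda>x. \<beta> x y u v)"
    "Vector_Spaces.linear scale scaleV (\<lambda>y. \<beta> x y u v)"
    "Vector_Spaces.linear scale scaleV (\<lambda>u. \<beta> x y u v)"
    "Vector_Spaces.linear scale scaleV (\<lambda>v. \<beta> x y u v)" for x y u v
    using assms by (simp_all add: bilinear_map_def)
  have "bilinear_map scale scaleV (\<lambda>x y. sweedler (\<lambda>u v. \<beta> x y u v) b)"
    "bilinear_map scale scaleV (\<lambda>u v. sweedler (\<lambda>x y. \<beta> x y u v) a)"
    unfolding bilinear_map_def
    by (intro conjI allI linear_sweedler_param assms lin)+
  note L = tensor_lift_sum_list[OF this(1)] tensor_lift_sum_list[OF this(2)]
    tensor_lift_sum_list[OF assms(1)] tensor_lift_sum_list[OF assms(2)]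
  have "(\<Sum>(x, y)\<leftarrow>as. \<Sum>(u, v)\<leftarrow>bs. \<beta> x y u v) = (\<Sum>(u, v)\<leftarrow>bs. \<Sum>(x, y)\<leftarrow>as. \<beta> x y u v)"
    by (induction as) (auto simp: case_prod_unfold sum_list_addf)
  then show ?thesis
    using L(1)[of as] L(2)[of bs] by (simp add: as bs L(3,4))
qed

lemma sum_sweedler:
  assumes "\<And>i. bilinear_map scale scaleV (\<beta> i)"
  shows "(\<Sum>i\<in>I. sweedler (\<beta> i) a) = sweedler (\<lambda>x y. \<Sum>i\<in>I. \<beta> i x y) a"
proof -
  obtain xs where xs: "\<Delta> a = (\<Sum>(x, y)\<leftarrow>xs. tens scale x y)" by (rule comult_sum_list)
  interpret V: vector_space scaleV by (rule bilinear_mapD[OF assms])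
  have "bilinear_map scale scaleV (\<lambda>x y. \<Sum>i\<in>I. \<beta> i x y)"
    by (rule bilinear_mapI) (simp_all add: vector_space_axioms V.vector_space_axioms
        bilinear_mapD[OF assms] sum.distrib V.scale_sum_right)
  moreover have "(\<Sum>i\<in>I. \<Sum>(x, y)\<leftarrow>xs. \<beta> i x y) = (\<Sum>(x, y)\<leftarrow>xs. \<Sum>i\<in>I. \<beta> i x y)"
    by (induction xs) (auto simp: sum.distrib)
  ultimately show ?thesis by (simp add: xs tensor_lift_sum_list[OF assms] tensor_lift_sum_list)
qed

lemma sweedler_form:
  assumes "bilinear_map scale (*) \<beta>"
  shows "sweedler \<beta> a = \<Delta> a \<beta>"
proof -
  obtain xs where "\<Delta> a = (\<Sum>(x, y)\<leftarrow>xs. tens scale x y)" by (rule comult_sum_list)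
  then show ?thesis by (simp add: tensor_lift_sum_list[OF assms] sum_list_tens_eval[OF assms])
qed

lemma linear_lact:
  assumes "linear_form scale p"
  shows "linear_endo scale (lact scale \<Delta> p)"
  unfolding linear_endo_def lact_def using assms
  by (intro linear_sweedler bilinear_mapI vector_space_axioms)
    (simp_all add: linear_form_def linear_mapD scale_left_distrib scale_right_distrib mult.commute)

text \<open>
  This turns the right action of the opposite coalgebra into the left action of the given one, and so
  the trace that defines \<open>\<E>\<close> for \<open>A\<^sup>c\<^sup>o\<^sup>p\<close> into a trace over \<open>A\<close>.
\<close>

lemma ract_comult_cop:
  assumes "linear_form scale p"
  shows "ract scale (comult_cop scale \<Delta>) p = lact scale \<Delta> p"
proof
  fix a
  obtain xs where xs: "\<Delta> a = (\<Sum>(x, y)\<leftarrow>xs. tens scale x y)" by (rule comult_sum_list)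
  note p = linear_mapD[OF assms[unfolded linear_form_def]]
  have swap: "bilinear_map scale fun_scale (\<lambda>x y. tens scale y x)"
    using bilinear_map_tens[OF vector_space_axioms] by (simp add: bilinear_map_def)
  have cop: "comult_cop scale \<Delta> a = (\<Sum>(x, y)\<leftarrow>map (\<lambda>(x, y). (y, x)) xs. tens scale x y)"
    by (simp add: comult_cop_def xs tensor_lift_sum_list[OF swap]) (simp add: case_prod_unfold o_def)
  have "bilinear_map scale scale (\<lambda>x y. scale (p x) y)" "bilinear_map scale scale (\<lambda>x y. scale (p y) x)"
    by (rule bilinear_mapI; simp add: vector_space_axioms p scale_left_distrib scale_right_distrib mult.commute)+
  then show "ract scale (comult_cop scale \<Delta>) p a = lact scale \<Delta> p a"
    unfolding ract_def lact_def cop xs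
    by (simp only: tensor_lift_sum_list) (simp add: case_prod_unfold o_def)
qed

end

section \<open>Coproducts of products\<close>

context bialgebra
begin

lemma linear_mult:
  "Vector_Spaces.linear scale scale (\<lambda>x. x * b)" "Vector_Spaces.linear scale scale (\<lambda>x. b * x)"
  by (auto intro!: vs_linearI vector_space_axioms simp: algebra_simps scale_mult_left scale_mult_right)

text \<open>
  Linear forms reduce this to scalar integrands \<open>\<gamma>\<close>.  For these a Sweedler sum is the value of the
  tensor at \<open>\<gamma>\<close>, so the claim is the multiplicativity of \<open>\<Delta>\<close> evaluated at \<open>\<gamma>\<close>.
\<close>

lemma sweedler_mult:
  fixes \<beta> :: "'a \<Rightarrow> 'a \<Rightarrow> 'v::ab_group_add"
  assumes \<beta>: "bilinear_map scale scaleV \<beta>"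
  shows "sweedler \<beta> (a * b) = sweedler (\<lambda>x y. sweedler (\<lambda>u v. \<beta> (x * u) (y * v)) b) a"
proof (rule linear_forms_separate)
  show "vector_space scaleV" by (rule bilinear_mapD[OF \<beta>])
  fix p assume "linear_form scaleV p"
  then have p: "Vector_Spaces.linear scaleV (*) p" by (simp add: linear_form_def)
  define \<gamma> where "\<gamma> = (\<lambda>x y. p (\<beta> x y))"
  have \<gamma>: "bilinear_map scale (*) \<gamma>" unfolding \<gamma>_def by (rule bilinear_map_compose[OF \<beta> p])
  have ev: "Vector_Spaces.linear fun_scale (*) (\<lambda>t. t \<gamma>)"
    by (intro vs_linearI vector_space_fun_scale vector_space_field) (auto simp: fun_scale_def)
  have bil: "bilinear_map scale scaleW (\<lambda>x y. \<delta> (x * u) (y * v))"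
    "bilinear_map scale scaleW (\<lambda>u v. \<delta> (x * u) (y * v))"
    if "bilinear_map scale scaleW \<delta>" for scaleW :: "'k \<Rightarrow> 'w::ab_group_add \<Rightarrow> 'w" and \<delta> x y u v
    by (intro bilinear_mapI; simp add: bilinear_mapD[OF that] algebra_simps scale_mult_left scale_mult_right)+
  have bil2: "bilinear_map scale scaleW (\<lambda>x y. sweedler (\<lambda>u v. \<delta> (x * u) (y * v)) b)"
    if "bilinear_map scale scaleW \<delta>" for scaleW :: "'k \<Rightarrow> 'w::ab_group_add \<Rightarrow> 'w" and \<delta>
    unfolding bilinear_map_def using bil[OF that]
    by (auto intro!: linear_sweedler_param simp: bilinear_map_def)
  have val: "tens scale x y \<gamma> = \<gamma> x y" for x y using \<gamma> by (simp add: tens_def)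
  note t = bilinear_map_tens[OF vector_space_axioms]
  have "p (sweedler \<beta> (a * b)) = \<Delta> (a * b) \<gamma>"
    by (simp add: sweedler_compose[OF p \<beta>] sweedler_form[OF \<gamma>] flip: \<gamma>_def)
  also have "\<dots> = sweedler (\<lambda>x y. sweedler (\<lambda>u v. \<gamma> (x * u) (y * v)) b) a"
    by (simp add: comult_mult sweedler_compose[OF ev bil2[OF t]] sweedler_compose[OF ev bil(2)[OF t]] val)
  also have "\<dots> = p (sweedler (\<lambda>x y. sweedler (\<lambda>u v. \<beta> (x * u) (y * v)) b) a)"
    by (simp add: sweedler_compose[OF p bil2[OF \<beta>]] sweedler_compose[OF p bil(2)[OF \<beta>]] \<gamma>_def)
  finally show "p (sweedler \<beta> (a * b)) = p (sweedler (\<lambda>x y. sweedler (\<lambda>u v. \<beta> (x * u) (y * v)) b) a)" .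
qed

end

section \<open>Convolution inverses, the antipode and integrals\<close>

context hopf_algebra
begin

lemmas antipode_map = linear_mapD[OF antipode_linear[unfolded linear_endo_def]]
lemmas counit_map = linear_mapD[OF counit_linear[unfolded linear_form_def]]

text \<open>
  The antipode is the convolution inverse of the identity, so the convolution equation
  \<open>K * id = c \<epsilon>\<close> has only the solution \<open>K = c s\<close>: expand
  \<open>K(a) = K(a\<^sub>1) a\<^sub>2 s(a\<^sub>3) = \<epsilon>(a\<^sub>1) c s(a\<^sub>2) = c s(a)\<close>.  The constant \<open>c \<in> A\<close> is allowed so that
  the lemma identifies maps that agree with \<open>s\<close> only up to a left factor.
\<close>

lemma linear_eq_mult_antipode:
  assumes K: "linear_endo scale K" and inv: "\<And>a. sweedler (\<lambda>x y. K x * y) a = scale (\<epsilon> a) c"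
  shows "K a = c * s a"
proof -
  note K' = K[unfolded linear_endo_def]
  note simps = vector_space_axioms linear_mapD[OF K'] antipode_map counit_map algebra_simps
    scale_mult_left scale_mult_right scale_left_distrib scale_right_distrib
  have "K a = sweedler (\<lambda>x y. K (scale (\<epsilon> y) x)) a"
    by (subst sweedler_compose[OF K', symmetric])
      (auto intro!: bilinear_mapI simp: simps counit_right)
  also have "\<dots> = sweedler (\<lambda>x y. K x * sweedler (\<lambda>u v. u * s v) y) a"
    by (simp add: antipode_right simps)
  also have "\<dots> = sweedler (\<lambda>x y. sweedler (\<lambda>u v. K x * u * s v) y) a"
    by (subst sweedler_compose[OF linear_mult(2)]) (auto intro!: bilinear_mapI simp: simps)
  also have "\<dots> = sweedler (\<lambda>x y. sweedler (\<lambda>u v. K u * v * s y) x) a"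
    by (rule sweedler_coassoc[symmetric]) (auto intro!: vs_linearI simp: simps)
  also have "\<dots> = sweedler (\<lambda>x y. sweedler (\<lambda>u v. K u * v) x * s y) a"
    by (subst sweedler_compose[OF linear_mult(1)]) (auto intro!: bilinear_mapI simp: simps)
  also have "\<dots> = sweedler (\<lambda>x y. c * s (scale (\<epsilon> x) y)) a"
    by (simp add: inv simps)
  also have "\<dots> = c * s (sweedler (\<lambda>x y. scale (\<epsilon> x) y) a)"
    using sweedler_compose[OF Vector_Spaces.linear_compose[OF antipode_linear[unfolded linear_endo_def] linear_mult(2)],
      of "\<lambda>x y. scale (\<epsilon> x) y" c a]
    by (simp add: bilinear_mapI simps)
  finally show ?thesis by (simp add: counit_left)
qed

text \<open>
  Two applications of the uniqueness of convolution inverses, one variable at a time.  For fixed \<open>a\<close>,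
  the map \<open>K(b) = s(a\<^sub>1 b) a\<^sub>2\<close> satisfies \<open>K(b\<^sub>1) b\<^sub>2 = \<epsilon>(a b) 1\<close>, since this is the antipode axiom at
  \<open>a b\<close>; hence \<open>s(a\<^sub>1 b) a\<^sub>2 = \<epsilon>(a) s(b)\<close>.  For fixed \<open>b\<close> this says that \<open>a \<mapsto> s(a b)\<close> solves the
  equation with constant \<open>s(b)\<close>.
\<close>

lemma antipode_mult: "s (a * b) = s b * s a"
proof -
  note simps = vector_space_axioms antipode_map counit_map algebra_simps
    scale_mult_left scale_mult_right scale_left_distrib scale_right_distrib
  have half: "sweedler (\<lambda>x y. s (x * b) * y) a = scale (\<epsilon> a) (s b)" for a b
  proof -
    have bil: "bilinear_map scale scale (\<lambda>x y. s (x * u) * y * v)"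
      "bilinear_map scale scale (\<lambda>u v. s (x * u) * y * v)"
      "bilinear_map scale scale (\<lambda>x y. s (x * u) * y)"
      "bilinear_map scale scale (\<lambda>x y. s x * y)" for x y u v
      by (auto intro!: bilinear_mapI simp: simps)
    have "sweedler (\<lambda>x y. s (x * b) * y) a = scale (\<epsilon> a) 1 * s b"
    proof (rule linear_eq_mult_antipode[where K = "\<lambda>b. sweedler (\<lambda>x y. s (x * b) * y) a"])
      show "linear_endo scale (\<lambda>b. sweedler (\<lambda>x y. s (x * b) * y) a)"
        unfolding linear_endo_def
        by (intro linear_sweedler_param bil) (auto intro!: vs_linearI simp: simps)
      fix b
      have "sweedler (\<lambda>u v. sweedler (\<lambda>x y. s (x * u) * y) a * v) b
        = sweedler (\<lambda>u v. sweedler (\<lambda>x y. s (x * u) * y * v) a) b"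
        by (subst sweedler_compose[OF linear_mult(1) bil(3)]) simp
      also have "\<dots> = sweedler (\<lambda>x y. sweedler (\<lambda>u v. s (x * u) * y * v) b) a"
        by (rule sweedler_swap[OF bil(1,2)])
      also have "\<dots> = sweedler (\<lambda>x y. s x * y) (a * b)"
        by (simp add: sweedler_mult[OF bil(4)] mult.assoc)
      also have "\<dots> = scale (\<epsilon> b) (scale (\<epsilon> a) 1)"
        by (simp add: antipode_left counit_mult mult.commute)
      finally show "sweedler (\<lambda>u v. sweedler (\<lambda>x y. s (x * u) * y) a * v) b
        = scale (\<epsilon> b) (scale (\<epsilon> a) 1)" .
    qed
    then show ?thesis by (simp add: simps)
  qed
  show ?thesis
    by (rule linear_eq_mult_antipode[where K = "\<lambda>a. s (a * b)", OF _ half])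
      (auto simp: linear_endo_def simps intro!: vs_linearI)
qed

text \<open>
  The invariance of a right integral of the dual in element form, \<open>l(a\<^sub>1) a\<^sub>2 = l(a) 1\<close>; testing it
  against every linear form is the defining condition.
\<close>

lemma dual_right_integral_invariance:
  assumes "l \<in> dual_right_integrals scale \<Delta>"
  shows "sweedler (\<lambda>x y. scale (l x) y) a = scale (l a) 1"
proof (rule linear_forms_separate[OF vector_space_axioms])
  fix p assume p: "linear_form scale p"
  note p' = p[unfolded linear_form_def]
  have l: "Vector_Spaces.linear scale (*) l" and inv: "dual_mult scale \<Delta> l p a = p 1 * l a"
    using assms p by (auto simp: dual_right_integrals_def linear_form_def)
  have "p (sweedler (\<lambda>x y. scale (l x) y) a) = sweedler (\<lambda>x y. p (scale (l x) y)) a"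
    by (rule sweedler_compose[OF p'], rule bilinear_mapI)
      (simp_all add: vector_space_axioms linear_mapD[OF l] scale_left_distrib scale_right_distrib mult.commute)
  also have "\<dots> = p (scale (l a) 1)"
    using inv by (simp add: dual_mult_def linear_mapD[OF p'])
  finally show "p (sweedler (\<lambda>x y. scale (l x) y) a) = p (scale (l a) 1)" .
qed

text \<open>
  Put \<open>K(a) = l(L\<^sub>1 a) L\<^sub>2\<close>.  Then \<open>K(a\<^sub>1) a\<^sub>2 = l((L a)\<^sub>1) (L a)\<^sub>2 = l(L a) 1 = \<epsilon>(a) l(L) 1\<close>, where the
  two integral properties enter in turn, and the uniqueness of convolution inverses gives
  \<open>K = l(L) s\<close>.
\<close>

lemma integrals_give_antipode:
  assumes l: "l \<in> dual_right_integrals scale \<Delta>" and L: "L \<in> right_integrals scale \<epsilon>"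
  shows "sweedler (\<lambda>x y. scale (l (x * a)) y) L = scale (l L) (s a)"
proof -
  have l': "Vector_Spaces.linear scale (*) l"
    using l by (simp add: dual_right_integrals_def linear_form_def)
  note simps = vector_space_axioms linear_mapD[OF l'] algebra_simps
    scale_mult_left scale_mult_right scale_left_distrib scale_right_distrib
  have bil: "bilinear_map scale scale (\<lambda>x y. scale (l x) y)"
    "bilinear_map scale scale (\<lambda>x y. scale (l (x * u)) y)"
    "bilinear_map scale scale (\<lambda>x y. scale (l (x * u)) (y * v))"
    "bilinear_map scale scale (\<lambda>u v. scale (l (x * u)) (y * v))" for x y u v
    by (auto intro!: bilinear_mapI simp: simps)
  have "sweedler (\<lambda>x y. scale (l (x * a)) y) L = scale (l L) 1 * s a"
  proof (rule linear_eq_mult_antipode[where K = "\<lambda>a. sweedler (\<lambda>x y. scale (l (x * a)) y) L"])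
    show "linear_endo scale (\<lambda>a. sweedler (\<lambda>x y. scale (l (x * a)) y) L)"
      unfolding linear_endo_def
      by (intro linear_sweedler_param bil) (auto intro!: vs_linearI simp: simps)
    fix a
    have "sweedler (\<lambda>u v. sweedler (\<lambda>x y. scale (l (x * u)) y) L * v) a
      = sweedler (\<lambda>u v. sweedler (\<lambda>x y. scale (l (x * u)) (y * v)) L) a"
      by (subst sweedler_compose[OF linear_mult(1) bil(2)]) (simp add: scale_mult_left)
    also have "\<dots> = sweedler (\<lambda>x y. sweedler (\<lambda>u v. scale (l (x * u)) (y * v)) a) L"
      by (rule sweedler_swap[OF bil(3,4)])
    also have "\<dots> = sweedler (\<lambda>x y. scale (l x) y) (L * a)"
      by (simp add: sweedler_mult[OF bil(1)])
    also have "\<dots> = scale (\<epsilon> a) (scale (l L) 1)"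
      using L by (simp add: dual_right_integral_invariance[OF l] right_integrals_def linear_mapD[OF l'])
    finally show "sweedler (\<lambda>u v. sweedler (\<lambda>x y. scale (l (x * u)) y) L * v) a
      = scale (\<epsilon> a) (scale (l L) 1)" .
  qed
  then show ?thesis by (simp add: scale_mult_left)
qed

end

section \<open>Traces in coordinates\<close>

context finite_dimensional_vector_space
begin

lemma linear_coordinate: "Vector_Spaces.linear scale (*) (\<lambda>v. representation Basis v b)"
  by (rule vs_linearI) (simp_all add: vector_space_axioms vector_space_field
      representation_add representation_scale independent_Basis span_Basis)

lemma linear_basis_expansion:
  assumes "Vector_Spaces.linear scale scaleV q"
  shows "q v = (\<Sum>b\<in>Basis. scaleV (representation Basis v b) (q b))"
proof -
  interpret q: Vector_Spaces.linear scale scaleV q by fact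
  have "v = (\<Sum>b\<in>Basis. scale (representation Basis v b) b)"
    using sum_representation_eq[OF independent_Basis _ finite_Basis subset_refl] span_Basis by simp
  then have "q v = q (\<Sum>b\<in>Basis. scale (representation Basis v b) b)" by (rule arg_cong)
  then show ?thesis by (simp only: q.sum q.scale)
qed

lemma endo_trace_Basis:
  assumes "linear_endo scale f"
  shows "endo_trace scale f = (\<Sum>b\<in>Basis. representation Basis (f b) b)"
  by (rule endo_trace_eq[OF assms finite_Basis independent_Basis span_Basis])

lemma linear_endo_comp:
  "linear_endo scale f \<Longrightarrow> linear_endo scale g \<Longrightarrow> linear_endo scale (f \<circ> g)"
  unfolding linear_endo_def by (rule Vector_Spaces.linear_compose)

lemma endo_trace_comp_commute:
  assumes f: "linear_endo scale f" and g: "linear_endo scale g"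
  shows "endo_trace scale (f \<circ> g) = endo_trace scale (g \<circ> f)"
proof -
  have *: "representation Basis (f v) b =
      (\<Sum>c\<in>Basis. representation Basis v c * representation Basis (f c) b)"
    if "linear_endo scale f" for f v b
    using linear_basis_expansion[OF Vector_Spaces.linear_compose[OF that[unfolded linear_endo_def] linear_coordinate],
        of b v]
    by simp
  have "endo_trace scale (f \<circ> g) = (\<Sum>b\<in>Basis. \<Sum>c\<in>Basis.
      representation Basis (g b) c * representation Basis (f c) b)"
    by (simp only: endo_trace_Basis linear_endo_comp f g comp_apply *[OF f, of "g v" for v])
  also have "\<dots> = (\<Sum>c\<in>Basis. \<Sum>b\<in>Basis.
      representation Basis (f c) b * representation Basis (g b) c)"
    by (subst sum.swap) (simp only: mult.commute)
  also have "\<dots> = endo_trace scale (g \<circ> f)"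
    by (simp only: endo_trace_Basis linear_endo_comp f g comp_apply *[OF g, of "f v" for v])
  finally show ?thesis .
qed

lemma endo_trace_linear_family:
  assumes "\<And>z. linear_endo scale (F z)" "\<And>x. Vector_Spaces.linear scaleU scale (\<lambda>z. F z x)"
  shows "Vector_Spaces.linear scaleU (*) (\<lambda>z. endo_trace scale (F z))"
proof (rule vs_linearI)
  note c = linear_mapD[OF linear_coordinate]
  show "vector_space scaleU" using linear_mapD[OF assms(2)] by simp
  show "endo_trace scale (F (x + y)) = endo_trace scale (F x) + endo_trace scale (F y)" for x y
    by (simp add: endo_trace_Basis assms(1) linear_mapD[OF assms(2)] c sum.distrib)
  show "endo_trace scale (F (scaleU r x)) = r * endo_trace scale (F x)" for r x
    by (simp add: endo_trace_Basis assms(1) linear_mapD[OF assms(2)] c sum_distrib_left)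
qed (rule vector_space_field)

end

lemma sum_rotate3:
  "(\<Sum>i\<in>A. \<Sum>j\<in>B. \<Sum>k\<in>C. g i j k) = (\<Sum>k\<in>C. \<Sum>i\<in>A. \<Sum>j\<in>B. g i j k)"
proof -
  have "(\<Sum>i\<in>A. \<Sum>j\<in>B. \<Sum>k\<in>C. g i j k) = (\<Sum>i\<in>A. \<Sum>k\<in>C. \<Sum>j\<in>B. g i j k)"
    by (rule sum.cong[OF refl], rule sum.swap)
  also have "\<dots> = (\<Sum>k\<in>C. \<Sum>i\<in>A. \<Sum>j\<in>B. g i j k)" by (rule sum.swap)
  finally show ?thesis .
qed

section \<open>Traces that contain the antipode\<close>

locale finite_dimensional_hopf_algebra =
  hopf_algebra scale \<Delta> \<epsilon> s + finite_dimensional_vector_space scale Basis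
  for scale :: "'k::field \<Rightarrow> 'a::ring_1 \<Rightarrow> 'a" and \<Delta> \<epsilon> s Basis
begin

lemma linear_lmult: "linear_endo scale (lmult a)" and linear_rmult: "linear_endo scale (rmult a)"
  using linear_mult by (simp_all add: linear_endo_def lmult_def rmult_def)

text \<open>
  By \<open>integrals_give_antipode\<close>, \<open>l(L) s(f(x)) = l(L\<^sub>1 f(x)) L\<^sub>2\<close>.  This writes \<open>l(L) (s \<circ> f)\<close> as a sum of
  endomorphisms \<open>x \<mapsto> q(x) y\<close> of rank at most one, and each of those has trace \<open>q(y)\<close>.
\<close>

lemma trace_antipode_comp:
  assumes l: "l \<in> dual_right_integrals scale \<Delta>" and L: "L \<in> right_integrals scale \<epsilon>"
    and f: "linear_endo scale f"
  shows "l L * endo_trace scale (s \<circ> f) = sweedler (\<lambda>x y. l (x * f y)) L"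
proof -
  have l': "Vector_Spaces.linear scale (*) l"
    using l by (simp add: dual_right_integrals_def linear_form_def)
  note c = linear_mapD[OF linear_coordinate]
  note simps = vector_space_axioms vector_space_field linear_mapD[OF l'] algebra_simps
    scale_mult_left scale_mult_right scale_left_distrib scale_right_distrib c
    linear_mapD[OF f[unfolded linear_endo_def]]
  have "l L * endo_trace scale (s \<circ> f) = (\<Sum>b\<in>Basis. representation Basis (scale (l L) (s (f b))) b)"
    by (simp add: endo_trace_Basis linear_endo_comp antipode_linear f c sum_distrib_left)
  also have "\<dots> = (\<Sum>b\<in>Basis. representation Basis (sweedler (\<lambda>x y. scale (l (x * f b)) y) L) b)"
    by (simp add: integrals_give_antipode[OF l L])
  also have "\<dots> = (\<Sum>b\<in>Basis. sweedler (\<lambda>x y. l (x * f b) * representation Basis y b) L)"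
    by (subst sweedler_compose[OF linear_coordinate]) (auto intro!: bilinear_mapI simp: simps)
  also have "\<dots> = sweedler (\<lambda>x y. \<Sum>b\<in>Basis. l (x * f b) * representation Basis y b) L"
    by (rule sum_sweedler[where scaleV = "(*)"]) (auto intro!: bilinear_mapI simp: simps)
  also have "\<dots> = sweedler (\<lambda>x y. l (x * f y)) L"
  proof -
    have "(\<Sum>b\<in>Basis. l (x * f b) * representation Basis y b) = l (x * f y)" for x y
      using linear_basis_expansion[of "(*)" "\<lambda>y. l (x * f y)" y]
      by (simp add: vs_linearI simps)
    then show ?thesis by simp
  qed
  finally show ?thesis .
qed

text \<open>
  Since \<open>s\<close> reverses products, \<open>s \<circ> r(a) = \<ell>(s(a)) \<circ> s\<close>; the rest is cyclicity of the trace.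
\<close>

lemma trace_lact_rmult:
  assumes p: "linear_form scale p"
  shows "endo_trace scale (s \<circ> lact scale \<Delta> p \<circ> s \<circ> rmult a) =
    endo_trace scale (lmult (s a) \<circ> (s \<circ> s) \<circ> lact scale \<Delta> p)"
proof -
  have "s \<circ> rmult a = lmult (s a) \<circ> s"
    by (auto simp: rmult_def lmult_def antipode_mult)
  then have "endo_trace scale (s \<circ> lact scale \<Delta> p \<circ> s \<circ> rmult a) =
      endo_trace scale ((s \<circ> lact scale \<Delta> p) \<circ> (lmult (s a) \<circ> s))"
    by (simp add: comp_assoc)
  also have "\<dots> = endo_trace scale ((lmult (s a) \<circ> s) \<circ> (s \<circ> lact scale \<Delta> p))"
    by (intro endo_trace_comp_commute linear_endo_comp antipode_linear linear_lact p linear_lmult)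
  finally show ?thesis by (simp add: comp_assoc)
qed

text \<open>
  Rotating the trace to \<open>tr (s \<circ> r(a) \<circ> s \<circ> \<ell>(p))\<close> lets \<open>trace_antipode_comp\<close> produce
  \<open>l(L\<^sub>1 s(L\<^sub>2) a) p(L\<^sub>3)\<close>, where \<open>L\<^sub>1\<close> stands next to \<open>s(L\<^sub>2)\<close> and the antipode axiom contracts the two.
\<close>

lemma trace_integrals:
  assumes l: "l \<in> dual_right_integrals scale \<Delta>" and L: "L \<in> right_integrals scale \<epsilon>"
    and p: "linear_form scale p"
  shows "l L * endo_trace scale (s \<circ> lact scale \<Delta> p \<circ> s \<circ> rmult a) = l a * p L"
proof -
  have l': "Vector_Spaces.linear scale (*) l"
    using l by (simp add: dual_right_integrals_def linear_form_def)
  note p' = p[unfolded linear_form_def]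
  note simps = vector_space_axioms vector_space_field linear_mapD[OF l'] linear_mapD[OF p'] algebra_simps
    scale_mult_left scale_mult_right scale_left_distrib scale_right_distrib antipode_map counit_map
  have "endo_trace scale (s \<circ> lact scale \<Delta> p \<circ> s \<circ> rmult a) =
      endo_trace scale ((s \<circ> rmult a) \<circ> (s \<circ> lact scale \<Delta> p))"
    using endo_trace_comp_commute[of "s \<circ> lact scale \<Delta> p" "s \<circ> rmult a"]
    by (simp add: linear_endo_comp antipode_linear linear_lact p linear_rmult comp_assoc)
  then have "l L * endo_trace scale (s \<circ> lact scale \<Delta> p \<circ> s \<circ> rmult a) =
      l L * endo_trace scale (s \<circ> (rmult a \<circ> s \<circ> lact scale \<Delta> p))"
    by (simp add: comp_assoc)
  also have "\<dots> = sweedler (\<lambda>x y. l (x * (s (lact scale \<Delta> p y) * a))) L"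
  proof -
    have "linear_endo scale (rmult a \<circ> s \<circ> lact scale \<Delta> p)"
      by (intro linear_endo_comp linear_rmult antipode_linear linear_lact p)
    from trace_antipode_comp[OF l L this] show ?thesis by (simp add: rmult_def)
  qed
  also have "\<dots> = sweedler (\<lambda>x y. sweedler (\<lambda>u v. p v * l (x * s u * a)) y) L"
  proof -
    have lin: "Vector_Spaces.linear scale (*) (\<lambda>z. l (x * (s z * a)))" for x
      by (auto intro!: vs_linearI simp: simps)
    have "l (x * (s (lact scale \<Delta> p y) * a)) = sweedler (\<lambda>u v. p v * l (x * s u * a)) y" for x y
      unfolding lact_def
      by (subst sweedler_compose[OF lin]) (auto intro!: bilinear_mapI simp: simps)
    then show ?thesis by simp
  qed
  also have "\<dots> = sweedler (\<lambda>x y. sweedler (\<lambda>u v. p y * l (u * s v * a)) x) L"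
    by (rule sweedler_coassoc[symmetric, where scaleV = "(*)"]) (auto intro!: vs_linearI simp: simps)
  also have "\<dots> = sweedler (\<lambda>x y. l a * p (scale (\<epsilon> x) y)) L"
  proof -
    have lin: "Vector_Spaces.linear scale (*) (\<lambda>z. p y * l (z * a))" for y
      by (auto intro!: vs_linearI simp: simps)
    have "sweedler (\<lambda>u v. p y * l (u * s v * a)) x = p y * l (sweedler (\<lambda>u v. u * s v) x * a)" for x y
      by (subst sweedler_compose[OF lin]) (auto intro!: bilinear_mapI simp: simps)
    then show ?thesis by (simp add: antipode_right simps)
  qed
  also have "\<dots> = l a * p (sweedler (\<lambda>x y. scale (\<epsilon> x) y) L)"
  proof -
    have lin: "Vector_Spaces.linear scale (*) (\<lambda>z. l a * p z)"
      by (auto intro!: vs_linearI simp: simps)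
    show ?thesis
      by (subst sweedler_compose[OF lin]) (auto intro!: bilinear_mapI simp: simps)
  qed
  finally show ?thesis by (simp add: counit_left)
qed


section \<open>The endomorphism-valued map of the opposite coalgebra\<close>

text \<open>
  The description that defines \<open>\<E>\<close> determines it, because linear forms separate points.  It is
  consistent because the trace on the right is linear in \<open>p\<close>: the endomorphism \<open>g\<close> whose
  coordinates are the traces for the coordinate forms satisfies it for all \<open>p\<close>.
\<close>

lemma hopf_E_characterization:
  assumes f: "linear_endo scale f" and p: "linear_form scale p"
  shows "p (hopf_E scale (comult_cop scale \<Delta>) f a) = endo_trace scale (lmult a \<circ> f \<circ> lact scale \<Delta> p)"
proof -
  let ?tr = "\<lambda>p a. endo_trace scale (lmult a \<circ> f \<circ> lact scale \<Delta> p)"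
  let ?c = "\<lambda>b v. representation Basis v b"
  define g where "g a = (\<Sum>b\<in>Basis. scale (?tr (?c b) a) b)" for a
  note c = linear_coordinate[folded linear_form_def]
  have lin: "linear_endo scale (lmult a \<circ> f \<circ> lact scale \<Delta> p)" if "linear_form scale p" for a p
    by (intro linear_endo_comp linear_lmult f linear_lact that)
  have lin_a: "Vector_Spaces.linear scale (*) (?tr p)" if "linear_form scale p" for p
    by (rule endo_trace_linear_family[OF lin[OF that]])
      (simp add: lmult_def linear_mult)
  have g: "linear_endo scale g"
    unfolding linear_endo_def g_def
    by (rule vs_linearI) (simp_all add: vector_space_axioms linear_mapD[OF lin_a[OF c]]
        scale_left_distrib sum.distrib scale_sum_right)
  have tr: "p (g a) = ?tr p a" if p: "linear_form scale p" for p a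
  proof -
    note p' = p[unfolded linear_form_def]
    interpret p: Vector_Spaces.linear scale "(*)" p by (rule p')
    have lact: "lact scale \<Delta> p x = (\<Sum>b\<in>Basis. scale (p b) (lact scale \<Delta> (?c b) x))" for x
    proof -
      have bil: "bilinear_map scale scale (\<lambda>x y. scale (?c b y) x)" for b
        by (rule bilinear_mapI) (simp_all only: vector_space_axioms linear_mapD(3,4)[OF linear_coordinate]
            scale_left_distrib scale_right_distrib scale_scale mult.commute)
      have "lact scale \<Delta> p x = sweedler (\<lambda>x y. \<Sum>b\<in>Basis. scale (p b) (scale (?c b y) x)) x"
      proof -
        have "scale (p y) z = (\<Sum>b\<in>Basis. scale (p b) (scale (?c b y) z))" for y z
          by (subst linear_basis_expansion[OF p', of y]) (simp add: scale_sum_left mult.commute)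
        then show ?thesis unfolding lact_def by (intro arg_cong[where f = "\<lambda>\<beta>. sweedler \<beta> x"] ext)
      qed
      also have "\<dots> = (\<Sum>b\<in>Basis. sweedler (\<lambda>x y. scale (p b) (scale (?c b y) x)) x)"
        by (rule sum_sweedler[symmetric], rule bilinear_map_compose[OF bil linear_scale_self])
      also have "\<dots> = (\<Sum>b\<in>Basis. scale (p b) (lact scale \<Delta> (?c b) x))"
        unfolding lact_def
        by (rule sum.cong[OF refl], rule sweedler_compose[OF linear_scale_self bil, symmetric])
      finally show ?thesis .
    qed
    interpret h: Vector_Spaces.linear scale scale "lmult a \<circ> f"
      using linear_endo_comp[OF linear_lmult f] by (simp add: linear_endo_def)
    have "?tr p a = (\<Sum>d\<in>Basis. \<Sum>b\<in>Basis. p b * representation Basis ((lmult a \<circ> f) (lact scale \<Delta> (?c b) d)) d)"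
    proof -
      have "representation Basis ((lmult a \<circ> f) (lact scale \<Delta> p d)) d =
        (\<Sum>b\<in>Basis. p b * representation Basis ((lmult a \<circ> f) (lact scale \<Delta> (?c b) d)) d)" for d
        unfolding lact h.sum h.scale
        by (simp add: representation_sum representation_scale independent_Basis span_Basis)
      then show ?thesis by (simp add: endo_trace_Basis[OF lin[OF p]])
    qed
    also have "\<dots> = (\<Sum>b\<in>Basis. p b * ?tr (?c b) a)"
      by (subst sum.swap) (simp add: endo_trace_Basis[OF lin[OF c]] sum_distrib_left)
    also have "\<dots> = p (g a)" by (simp add: g_def p.sum p.scale mult.commute)
    finally show ?thesis by simp
  qed
  have "hopf_E scale (comult_cop scale \<Delta>) f = g"
    unfolding hopf_E_def
  proof (rule the_equality)
    show "linear_endo scale g \<and> (\<forall>p a. linear_form scale p \<longrightarrow>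
        p (g a) = endo_trace scale (lmult a \<circ> f \<circ> ract scale (comult_cop scale \<Delta>) p))"
      by (simp add: g tr ract_comult_cop)
    fix h assume h: "linear_endo scale h \<and> (\<forall>p a. linear_form scale p \<longrightarrow>
        p (h a) = endo_trace scale (lmult a \<circ> f \<circ> ract scale (comult_cop scale \<Delta>) p))"
    show "h = g"
    proof
      fix a show "h a = g a"
        by (rule linear_forms_separate[OF vector_space_axioms]) (simp add: h tr ract_comult_cop)
    qed
  qed
  then show ?thesis by (simp add: tr p)
qed

section \<open>Uniqueness of integrals and cointegrals\<close>

lemma integral_and_cointegral_value:
  "integral_and_cointegral scale \<Delta> \<epsilon> Q \<Longrightarrow> Q x \<in> right_integrals scale \<epsilon>"
  by (simp add: integral_and_cointegral_def right_integrals_def)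

text \<open>
  An integral and cointegral is built from integrals: its values are right integrals of \<open>A\<close>, and
  composing it with linear forms gives right integrals of the dual.
\<close>

lemma integral_and_cointegral_form:
  assumes Q: "integral_and_cointegral scale \<Delta> \<epsilon> Q" and p: "linear_form scale p"
  shows "(\<lambda>x. p (Q x)) \<in> dual_right_integrals scale \<Delta>"
proof -
  have lin: "Vector_Spaces.linear scale scale Q"
    and inv: "tensor_lift scale (\<lambda>x y. tens scale (Q x) y) (\<Delta> a) = tens scale (Q a) 1" for a
    using Q by (simp_all add: integral_and_cointegral_def linear_endo_def)
  note p' = p[unfolded linear_form_def]
  have "dual_mult scale \<Delta> (\<lambda>x. p (Q x)) q a = q 1 * p (Q a)" if q: "linear_form scale q" for q a
  proof -
    note q' = q[unfolded linear_form_def]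
    define \<gamma> where "\<gamma> = (\<lambda>x y. p x * q y)"
    have \<gamma>: "bilinear_map scale (*) \<gamma>" unfolding \<gamma>_def
      by (rule bilinear_mapI) (simp_all add: vector_space_axioms vector_space_field
          linear_mapD[OF p'] linear_mapD[OF q'] algebra_simps)
    have ev: "Vector_Spaces.linear fun_scale (*) (\<lambda>t. t \<gamma>)"
      by (intro vs_linearI vector_space_fun_scale vector_space_field) (auto simp: fun_scale_def)
    have bil: "bilinear_map scale fun_scale (\<lambda>x y. tens scale (Q x) y)"
      using bilinear_mapD[OF bilinear_map_tens[OF vector_space_axioms]]
      by (intro bilinear_mapI) (simp_all add: linear_mapD[OF lin])
    have val: "tens scale x y \<gamma> = \<gamma> x y" for x y using \<gamma> by (simp add: tens_def)
    show ?thesis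
      using arg_cong[OF inv[of a], of "\<lambda>t. t \<gamma>"]
      by (simp add: sweedler_compose[OF ev bil] val) (simp add: \<gamma>_def dual_mult_def mult.commute)
  qed
  then show "(\<lambda>x. p (Q x)) \<in> dual_right_integrals scale \<Delta>"
    using Vector_Spaces.linear_compose[OF lin p']
    by (auto simp: dual_right_integrals_def linear_form_def o_def)
qed

text \<open>
  Any endomorphism \<open>P\<close> with \<open>l(L) P = l \<otimes> L\<close> for all integrals forces uniqueness.  A nonzero \<open>Q\<close> supplies
  integrals \<open>l = p \<circ> Q\<close> and \<open>L = Q(x)\<close> with \<open>l \<otimes> L \<noteq> 0\<close>, hence with \<open>l(L) \<noteq> 0\<close>.  This pair shows that
  every integral and cointegral \<open>R\<close> is a multiple of \<open>P\<close>: first \<open>l(L) R = l \<otimes> R(L)\<close>, then, as \<open>R(L)\<close> is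
  again an integral, \<open>l \<otimes> R(L) = l(R(L)) P\<close>.
\<close>

lemma integral_and_cointegral_unique:
  assumes P: "\<And>l L a. l \<in> dual_right_integrals scale \<Delta> \<Longrightarrow> L \<in> right_integrals scale \<epsilon> \<Longrightarrow>
      scale (l L) (P a) = scale (l a) L"
    and Q: "integral_and_cointegral scale \<Delta> \<epsilon> Q" "Q \<noteq> (\<lambda>_. 0)"
    and Q': "integral_and_cointegral scale \<Delta> \<epsilon> Q'"
  obtains c where "Q' = (\<lambda>a. scale c (Q a))"
proof -
  obtain x where x: "Q x \<noteq> 0" using Q(2) by auto
  have "\<exists>p. linear_form scale p \<and> p (Q x) \<noteq> 0"
  proof (rule ccontr)
    assume neg: "\<not> ?thesis"
    have "Q x = 0"
    proof (rule linear_forms_separate[OF vector_space_axioms])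
      fix p assume p: "linear_form scale p"
      then show "p (Q x) = p 0" using neg linear_mapD(5)[OF p[unfolded linear_form_def]] by auto
    qed
    with x show False by simp
  qed
  then obtain p where p: "linear_form scale p" and px: "p (Q x) \<noteq> 0" by blast
  define l where "l = (\<lambda>y. p (Q y))"
  define L where "L = Q x"
  have l: "l \<in> dual_right_integrals scale \<Delta>" unfolding l_def by (rule integral_and_cointegral_form[OF Q(1) p])
  have L: "L \<in> right_integrals scale \<epsilon>" unfolding L_def by (rule integral_and_cointegral_value[OF Q(1)])
  define d where "d = l L"
  have d: "d \<noteq> 0"
    using P[OF l L, of x] px x by (auto simp: d_def l_def L_def)
  have mult_P: "\<exists>c. \<forall>a. R a = scale c (P a)" if R: "integral_and_cointegral scale \<Delta> \<epsilon> R" for R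
  proof -
    have RL: "R L \<in> right_integrals scale \<epsilon>" by (rule integral_and_cointegral_value[OF R])
    \<comment> \<open>For each linear form \<open>q\<close>, both sides are coefficients of the nonzero vector \<open>L\<close>.\<close>
    have "scale d (R a) = scale (l a) (R L)" for a
    proof (rule linear_forms_separate[OF vector_space_axioms])
      fix q assume q: "linear_form scale q"
      note q' = linear_mapD[OF q[unfolded linear_form_def]]
      have "scale (d * q (R a)) L = scale (d * q (R L)) (P a)"
        using P[OF integral_and_cointegral_form[OF R q] L, of a] by (metis scale_scale)
      also have "\<dots> = scale (q (R L) * l a) L"
        using P[OF l L, of a] by (metis d_def mult.commute scale_scale)
      finally have "d * q (R a) = q (R L) * l a" using x by (simp add: L_def)
      then show "q (scale d (R a)) = q (scale (l a) (R L))" by (simp add: q')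
    qed
    then have "scale d (R a) = scale (l (R L)) (P a)" for a by (simp add: P[OF l RL])
    then have "R a = scale (l (R L) / d) (P a)" for a
      using d by (metis scale_left_imp_eq scale_scale nonzero_mult_div_cancel_left times_divide_eq_right)
    then show ?thesis by blast
  qed
  from mult_P[OF Q(1)] mult_P[OF Q'] obtain c c'
    where c: "\<And>a. Q a = scale c (P a)" and c': "\<And>a. Q' a = scale c' (P a)" by blast
  have "c \<noteq> 0" using x c by auto
  then have "Q' = (\<lambda>a. scale (c' / c) (Q a))" by (auto simp: c c')
  then show thesis by (rule that)
qed

lemma coordinate_lact:
  assumes p: "linear_form scale p"
  shows "representation Basis (lact scale \<Delta> p x) b = \<Delta> x (\<lambda>u v. representation Basis u b * p v)"
proof -
  note simps = vector_space_axioms vector_space_field linear_mapD[OF linear_coordinate]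
    linear_mapD[OF p[unfolded linear_form_def]] algebra_simps scale_left_distrib scale_right_distrib
  have bil: "bilinear_map scale (*) (\<lambda>u v. representation Basis u b * p v)"
    by (rule bilinear_mapI) (simp_all add: simps)
  have "representation Basis (lact scale \<Delta> p x) b = sweedler (\<lambda>u v. representation Basis u b * p v) x"
    unfolding lact_def
    by (subst sweedler_compose[OF linear_coordinate]) (auto intro!: bilinear_mapI simp: simps)
  then show ?thesis by (simp add: sweedler_form[OF bil])
qed

section \<open>The trace in structure constants\<close>

text \<open>
  The fourfold sum is read off from the diagonal of the matrix of \<open>\<ell>(p) \<circ> s \<circ> r(e j) \<circ> s\<close>, a cyclic
  rotation of the endomorphism in the statement: starting at \<open>e v\<close>, the factors contribute \<open>S w v\<close>,
  \<open>m l w j\<close>, \<open>S u l\<close> and \<open>D v i u * p (e i)\<close>, the last one because only the terms of \<open>\<Delta> (e u)\<close> with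
  first factor \<open>e v\<close> return to \<open>e v\<close>.
\<close>

lemma trace_structure_constants:
  fixes e :: "'i \<Rightarrow> 'a" and I :: "'i set" and m D :: "'i \<Rightarrow> 'i \<Rightarrow> 'i \<Rightarrow> 'k" and S :: "'i \<Rightarrow> 'i \<Rightarrow> 'k"
  assumes e: "bij_betw e I Basis"
    and mult_coeffs: "\<And>i j. i \<in> I \<Longrightarrow> j \<in> I \<Longrightarrow> e i * e j = (\<Sum>l\<in>I. scale (m l i j) (e l))"
    and comult_coeffs: "\<And>l. l \<in> I \<Longrightarrow>
      \<Delta> (e l) = (\<Sum>i\<in>I. \<Sum>j\<in>I. fun_scale (D i j l) (tens scale (e i) (e j)))"
    and antipode_coeffs: "\<And>j. j \<in> I \<Longrightarrow> s (e j) = (\<Sum>i\<in>I. scale (S i j) (e i))"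
    and p: "linear_form scale p" and j: "j \<in> I"
  shows "endo_trace scale (s \<circ> lact scale \<Delta> p \<circ> s \<circ> rmult (e j)) =
    p (\<Sum>i\<in>I. scale (\<Sum>l\<in>I. \<Sum>u\<in>I. \<Sum>v\<in>I. \<Sum>w\<in>I. m l w j * S u l * D v i u * S w v) (e i))"
proof -
  note p_hom = linear_mapD[OF p[unfolded linear_form_def]]
  have finI: "finite I" using bij_betw_finite[OF e] finite_Basis by simp
  have coord: "representation Basis (e i) (e v) = (if i = v then 1 else 0)" if "i \<in> I" "v \<in> I" for i v
  proof -
    have "e i \<in> Basis" using e that by (auto simp: bij_betw_def)
    from representation_basis[OF independent_Basis this] show ?thesis
      using e that by (auto simp: bij_betw_def inj_on_def)
  qed
  have lact_coord: "representation Basis (lact scale \<Delta> p (e u)) (e v) = (\<Sum>i\<in>I. D v i u * p (e i))"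
    if "u \<in> I" "v \<in> I" for u v
  proof -
    define \<gamma> where "\<gamma> = (\<lambda>x y. representation Basis x (e v) * p y)"
    have "bilinear_map scale (*) \<gamma>" unfolding \<gamma>_def
      by (rule bilinear_mapI) (simp_all add: vector_space_axioms vector_space_field
          linear_mapD[OF linear_coordinate] p_hom algebra_simps)
    then have val: "tens scale x y \<gamma> = \<gamma> x y" for x y by (simp add: tens_def)
    have ev: "Vector_Spaces.linear fun_scale (*) (\<lambda>t. t \<gamma>)"
      by (intro vs_linearI vector_space_fun_scale vector_space_field) (auto simp: fun_scale_def)
    have "representation Basis (lact scale \<Delta> p (e u)) (e v) =
        (\<Sum>i\<in>I. \<Sum>k\<in>I. D i k u * (representation Basis (e i) (e v) * p (e k)))"
      by (simp add: coordinate_lact[OF p] comult_coeffs that(1) linear_mapD(4,6)[OF ev] val flip: \<gamma>_def)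
        (simp add: \<gamma>_def)
    also have "\<dots> = (\<Sum>i\<in>I. if i = v then (\<Sum>k\<in>I. D v k u * p (e k)) else 0)"
      by (rule sum.cong) (auto simp: coord that(2))
    also have "\<dots> = (\<Sum>i\<in>I. D v i u * p (e i))"
      using finI that(2) by (simp add: sum.delta)
    finally show ?thesis .
  qed
  let ?f = "lact scale \<Delta> p \<circ> s \<circ> rmult (e j) \<circ> s"
  have f: "linear_endo scale ?f"
    by (intro linear_endo_comp linear_rmult antipode_linear linear_lact p)
  have expand: "?f (e v) = (\<Sum>w\<in>I. scale (S w v) (\<Sum>l\<in>I. scale (m l w j)
      (\<Sum>u\<in>I. scale (S u l) (lact scale \<Delta> p (e u)))))" if "v \<in> I" for v
  proof -
    note hom = linear_mapD(4,6)[OF linear_rmult[unfolded linear_endo_def]] antipode_map(4,6)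
      linear_mapD(4,6)[OF linear_lact[OF p, unfolded linear_endo_def]]
    have "rmult (e j) (e w) = (\<Sum>l\<in>I. scale (m l w j) (e l))" if "w \<in> I" for w
      using that j by (simp add: rmult_def mult_coeffs)
    then show ?thesis
      using that by (simp add: antipode_coeffs hom)
  qed
  have "endo_trace scale (s \<circ> lact scale \<Delta> p \<circ> s \<circ> rmult (e j)) = endo_trace scale ?f"
    using endo_trace_comp_commute[OF antipode_linear, of "lact scale \<Delta> p \<circ> s \<circ> rmult (e j)"]
    by (simp add: linear_endo_comp antipode_linear linear_lact p linear_rmult comp_assoc)
  also have "\<dots> = (\<Sum>v\<in>I. representation Basis (?f (e v)) (e v))"
    unfolding endo_trace_Basis[OF f] using sum.reindex_bij_betw[OF e] by (rule sym)
  also have "\<dots> = (\<Sum>v\<in>I. \<Sum>w\<in>I. \<Sum>l\<in>I. \<Sum>u\<in>I. \<Sum>i\<in>I.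
      m l w j * S u l * D v i u * S w v * p (e i))"
  proof (rule sum.cong[OF refl])
    fix v assume v: "v \<in> I"
    show "representation Basis (?f (e v)) (e v) = (\<Sum>w\<in>I. \<Sum>l\<in>I. \<Sum>u\<in>I. \<Sum>i\<in>I.
      m l w j * S u l * D v i u * S w v * p (e i))"
      unfolding expand[OF v] linear_mapD(4,6)[OF linear_coordinate]
      by (simp add: lact_coord v sum_distrib_left mult_ac)
  qed
  also have "\<dots> = (\<Sum>i\<in>I. \<Sum>l\<in>I. \<Sum>u\<in>I. \<Sum>v\<in>I. \<Sum>w\<in>I.
      m l w j * S u l * D v i u * S w v * p (e i))"
  proof -
    let ?F = "\<lambda>v w l u i. m l w j * S u l * D v i u * S w v * p (e i)"
    have "(\<Sum>v\<in>I. \<Sum>w\<in>I. \<Sum>l\<in>I. \<Sum>u\<in>I. \<Sum>i\<in>I. ?F v w l u i) =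
        (\<Sum>l\<in>I. \<Sum>v\<in>I. \<Sum>w\<in>I. \<Sum>u\<in>I. \<Sum>i\<in>I. ?F v w l u i)"
      by (rule sum_rotate3)
    also have "\<dots> = (\<Sum>l\<in>I. \<Sum>u\<in>I. \<Sum>v\<in>I. \<Sum>w\<in>I. \<Sum>i\<in>I. ?F v w l u i)"
      by (rule sum.cong[OF refl], rule sum_rotate3)
    also have "\<dots> = (\<Sum>l\<in>I. \<Sum>u\<in>I. \<Sum>i\<in>I. \<Sum>v\<in>I. \<Sum>w\<in>I. ?F v w l u i)"
      by (rule sum.cong[OF refl], rule sum.cong[OF refl], rule sum_rotate3)
    also have "\<dots> = (\<Sum>i\<in>I. \<Sum>l\<in>I. \<Sum>u\<in>I. \<Sum>v\<in>I. \<Sum>w\<in>I. ?F v w l u i)"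
      by (rule sum_rotate3)
    finally show ?thesis .
  qed
  also have "\<dots> = p (\<Sum>i\<in>I. scale (\<Sum>l\<in>I. \<Sum>u\<in>I. \<Sum>v\<in>I. \<Sum>w\<in>I.
      m l w j * S u l * D v i u * S w v) (e i))"
    by (simp add: p_hom(4,6) sum_distrib_right)
  finally show ?thesis .
qed

lemma linear_trace_rmult:
  assumes p: "linear_form scale p"
  shows "Vector_Spaces.linear scale (*) (\<lambda>a. endo_trace scale (s \<circ> lact scale \<Delta> p \<circ> s \<circ> rmult a))"
proof (rule endo_trace_linear_family)
  have f: "linear_endo scale (s \<circ> lact scale \<Delta> p \<circ> s)"
    by (intro linear_endo_comp antipode_linear linear_lact p)
  then show "linear_endo scale (s \<circ> lact scale \<Delta> p \<circ> s \<circ> rmult a)" for a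
    by (rule linear_endo_comp[OF _ linear_rmult])
  show "Vector_Spaces.linear scale scale (\<lambda>a. (s \<circ> lact scale \<Delta> p \<circ> s \<circ> rmult a) x)" for x
    using Vector_Spaces.linear_compose[OF linear_mult(2) f[unfolded linear_endo_def], of x]
    by (simp add: rmult_def o_def)
qed

end

section \<open>The endomorphism given by the structure constants\<close>

theorem theorem2:
  fixes scale :: "'k::field \<Rightarrow> 'a::ring_1 \<Rightarrow> 'a"
    and \<Delta> :: "'a \<Rightarrow> ('k, 'a) tensor"
    and \<epsilon> :: "'a \<Rightarrow> 'k"
    and s P :: "'a \<Rightarrow> 'a"
    and n :: nat
    and e :: "nat \<Rightarrow> 'a"
    and m D :: "nat \<Rightarrow> nat \<Rightarrow> nat \<Rightarrow> 'k"
    and S :: "nat \<Rightarrow> nat \<Rightarrow> 'k"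
  assumes hopf: "hopf_algebra scale \<Delta> \<epsilon> s"
    and basis: "inj_on e {1..n}" "\<not> module.dependent scale (e ` {1..n})"
      "module.span scale (e ` {1..n}) = UNIV"
    and mult_coeffs: "\<And>i j. i \<in> {1..n} \<Longrightarrow> j \<in> {1..n} \<Longrightarrow>
      e i * e j = (\<Sum>l=1..n. scale (m l i j) (e l))"
    and comult_coeffs: "\<And>l. l \<in> {1..n} \<Longrightarrow>
      \<Delta> (e l) = (\<Sum>i=1..n. \<Sum>j=1..n. fun_scale (D i j l) (tens scale (e i) (e j)))"
    and antipode_coeffs: "\<And>j. j \<in> {1..n} \<Longrightarrow> s (e j) = (\<Sum>i=1..n. scale (S i j) (e i))"
    and P_linear: "linear_endo scale P"
    and P_basis: "\<And>j. j \<in> {1..n} \<Longrightarrow>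
      P (e j) = (\<Sum>i=1..n.
        scale (\<Sum>l=1..n. \<Sum>u=1..n. \<Sum>v=1..n. \<Sum>w=1..n. m l w j * S u l * D v i u * S w v) (e i))"
  shows
    "(\<forall>p a. linear_form scale p \<longrightarrow>
        p (P a) = endo_trace scale (s \<circ> lact scale \<Delta> p \<circ> s \<circ> rmult a) \<and>
        endo_trace scale (s \<circ> lact scale \<Delta> p \<circ> s \<circ> rmult a) =
          endo_trace scale (lmult (s a) \<circ> (s \<circ> s) \<circ> lact scale \<Delta> p)) \<and>
      P = hopf_E scale (comult_cop scale \<Delta>) (s \<circ> s) \<circ> s \<and>
      (\<forall>Q Q'. integral_and_cointegral scale \<Delta> \<epsilon> Q \<and> Q \<noteq> (\<lambda>_. 0) \<and>
        integral_and_cointegral scale \<Delta> \<epsilon> Q' \<longrightarrow> (\<exists>c. Q' = (\<lambda>a. scale c (Q a)))) \<and>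
     (\<forall>l L. l \<in> dual_right_integrals scale \<Delta> \<and> L \<in> right_integrals scale \<epsilon> \<and> l L = 1 \<longrightarrow>
        P = dual_tens scale l L)"
proof -
  interpret hopf_algebra scale \<Delta> \<epsilon> s by (rule hopf)
  interpret finite_dimensional_hopf_algebra scale \<Delta> \<epsilon> s "e ` {1..n}"
    by unfold_locales (use basis in simp_all)
  have e: "bij_betw e {1..n} (e ` {1..n})" using basis(1) by (rule inj_on_imp_bij_betw)
  \<comment> \<open>Both sides are linear in \<open>a\<close>, so it suffices to compare them on the basis.\<close>
  have trace_P: "p (P a) = endo_trace scale (s \<circ> lact scale \<Delta> p \<circ> s \<circ> rmult a)"
    if p: "linear_form scale p" for p a
  proof -
    have "Vector_Spaces.linear scale (*) (\<lambda>a. p (P a))"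
      using Vector_Spaces.linear_compose[OF P_linear[unfolded linear_endo_def] p[unfolded linear_form_def]]
      by (simp add: o_def)
    note exp = linear_basis_expansion[OF this, of a] linear_basis_expansion[OF linear_trace_rmult[OF p], of a]
    have "p (P b) = endo_trace scale (s \<circ> lact scale \<Delta> p \<circ> s \<circ> rmult b)" if "b \<in> e ` {1..n}" for b
      using that trace_structure_constants[OF e mult_coeffs comult_coeffs antipode_coeffs p] P_basis
      by auto
    then show ?thesis unfolding exp by (intro sum.cong) auto
  qed
  have P_integrals: "scale (l L) (P a) = scale (l a) L"
    if "l \<in> dual_right_integrals scale \<Delta>" "L \<in> right_integrals scale \<epsilon>" for l L a
  proof (rule linear_forms_separate[OF vector_space_axioms])
    fix p assume p: "linear_form scale p"
    then show "p (scale (l L) (P a)) = p (scale (l a) L)"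
      using trace_integrals[OF that p, of a]
      by (simp add: trace_P linear_mapD(4)[OF p[unfolded linear_form_def]])
  qed
  have via_E: "P = hopf_E scale (comult_cop scale \<Delta>) (s \<circ> s) \<circ> s"
  proof
    fix a
    show "P a = (hopf_E scale (comult_cop scale \<Delta>) (s \<circ> s) \<circ> s) a"
      by (rule linear_forms_separate[OF vector_space_axioms])
        (simp add: trace_P trace_lact_rmult hopf_E_characterization linear_endo_comp antipode_linear)
  qed
  have unique: "\<exists>c. Q' = (\<lambda>a. scale c (Q a))"
    if "integral_and_cointegral scale \<Delta> \<epsilon> Q" "Q \<noteq> (\<lambda>_. 0)" "integral_and_cointegral scale \<Delta> \<epsilon> Q'" for Q Q'
    using integral_and_cointegral_unique[OF P_integrals that] by blast
  have normalized: "P = dual_tens scale l L"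
    if "l \<in> dual_right_integrals scale \<Delta>" "L \<in> right_integrals scale \<epsilon>" "l L = 1" for l L
    using P_integrals[OF that(1,2)] that(3) by (auto simp: dual_tens_def)
  show ?thesis
  proof (intro conjI allI impI)
    show "P = hopf_E scale (comult_cop scale \<Delta>) (s \<circ> s) \<circ> s" by (rule via_E)
  qed (use unique normalized in \<open>auto simp: trace_P trace_lact_rmult\<close>)
qed

end
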